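(* Let $T \in \mathbb{F}^{n_1} \otimes \mathbb{F}^{n_2} \otimes \mathbb{F}^{n_3}$ be concise. Then $\lim_{m\to\infty} Q(T^{\boxtimes m})^{1/m} \geq (\min_{i} n_i)^{1/3}$.
   Context: $\mathbb{F}$ is any field. $T$ is concise if each of its three flattenings (the $n_i\times(n_jn_k)$ matrices obtained by grouping two tensor legs) has rank $n_i$. The subrank $Q(T)$ is the largest $r$ such that there are linear maps $L_i:\mathbb{F}^{n_i}\to\mathbb{F}^r$ with $(L_1\otimes L_2\otimes L_3)T=\sum_{i=1}^r e_i\otimes e_i\otimes e_i$; $\boxtimes$ denotes the Kronecker product of tensors, and $\lim_{m\to\infty} Q(T^{\boxtimes m})^{1/m}$ is the asymptotic subrank. *)

theory Defs
  imports Complex_Main "Jordan_Normal_Form.DL_Rank"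
begin

text \<open>
  A tensor in \<open>F\<^sup>n1 \<otimes> F\<^sup>n2 \<otimes> F\<^sup>n3\<close> is given by its coordinates \<open>T i j k\<close> for
  \<open>i < n1\<close>, \<open>j < n2\<close>, \<open>k < n3\<close>. The dimensions are explicit parameters (those of a Kronecker
  power depend on the exponent), and entries outside these ranges are never inspected.
\<close>

type_synonym 'a tensor = "nat \<Rightarrow> nat \<Rightarrow> nat \<Rightarrow> 'a"

text \<open>
  In each flattening a pair of legs of dimensions \<open>p\<close> and \<open>q\<close> is enumerated lexicographically:
  the pair \<open>(x, y)\<close> has number \<open>x * q + y\<close>.
\<close>

definition flattening1 :: "nat \<Rightarrow> nat \<Rightarrow> nat \<Rightarrow> 'a tensor \<Rightarrow> 'a mat" where
  "flattening1 n1 n2 n3 T = mat n1 (n2 * n3) (\<lambda>(i, c). T i (c div n3) (c mod n3))"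

definition flattening2 :: "nat \<Rightarrow> nat \<Rightarrow> nat \<Rightarrow> 'a tensor \<Rightarrow> 'a mat" where
  "flattening2 n1 n2 n3 T = mat n2 (n1 * n3) (\<lambda>(j, c). T (c div n3) j (c mod n3))"

definition flattening3 :: "nat \<Rightarrow> nat \<Rightarrow> nat \<Rightarrow> 'a tensor \<Rightarrow> 'a mat" where
  "flattening3 n1 n2 n3 T = mat n3 (n1 * n2) (\<lambda>(k, c). T (c div n2) (c mod n2) k)"

text \<open>The first argument of \<^const>\<open>vec_space.rank\<close> is the number of rows of the matrix.\<close>

definition concise :: "nat \<Rightarrow> nat \<Rightarrow> nat \<Rightarrow> 'a::field tensor \<Rightarrow> bool" where
  "concise n1 n2 n3 T \<longleftrightarrow>
     vec_space.rank n1 (flattening1 n1 n2 n3 T) = n1 \<and>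
     vec_space.rank n2 (flattening2 n1 n2 n3 T) = n2 \<and>
     vec_space.rank n3 (flattening3 n1 n2 n3 T) = n3"

definition unit_tensor :: "'a::field tensor" where
  "unit_tensor a b c = (if a = b \<and> b = c then 1 else 0)"

text \<open>\<open>(A \<otimes> B \<otimes> C) T\<close>, for linear maps given by matrices with \<open>n1\<close>, \<open>n2\<close>, \<open>n3\<close> columns.\<close>

definition apply_maps ::
  "nat \<Rightarrow> nat \<Rightarrow> nat \<Rightarrow> 'a::field mat \<Rightarrow> 'a mat \<Rightarrow> 'a mat \<Rightarrow> 'a tensor \<Rightarrow> 'a tensor" where
  "apply_maps n1 n2 n3 A B C T a b c =
     (\<Sum>i<n1. \<Sum>j<n2. \<Sum>k<n3. A $$ (a, i) * B $$ (b, j) * C $$ (c, k) * T i j k)"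

definition restricts_to_unit :: "nat \<Rightarrow> nat \<Rightarrow> nat \<Rightarrow> 'a::field tensor \<Rightarrow> nat \<Rightarrow> bool" where
  "restricts_to_unit n1 n2 n3 T r \<longleftrightarrow>
     (\<exists>A\<in>carrier_mat r n1. \<exists>B\<in>carrier_mat r n2. \<exists>C\<in>carrier_mat r n3.
        \<forall>a<r. \<forall>b<r. \<forall>c<r. apply_maps n1 n2 n3 A B C T a b c = unit_tensor a b c)"

text \<open>The greatest \<open>r\<close> exists: \<open>r = 0\<close> always qualifies, and \<open>r \<le> min n1 (min n2 n3)\<close>.\<close>

definition subrank :: "nat \<Rightarrow> nat \<Rightarrow> nat \<Rightarrow> 'a::field tensor \<Rightarrow> nat" where
  "subrank n1 n2 n3 T = (GREATEST r. restricts_to_unit n1 n2 n3 T r)"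

text \<open>
  Kronecker product of \<open>S\<close> with a tensor \<open>T\<close> of dimensions \<open>n1\<close>, \<open>n2\<close>, \<open>n3\<close>: in each leg the pair
  of basis indices \<open>(x, y)\<close> has number \<open>x * n + y\<close>, where \<open>n\<close> is the dimension of that leg of \<open>T\<close>.
\<close>

definition kronecker :: "nat \<Rightarrow> nat \<Rightarrow> nat \<Rightarrow> 'a::field tensor \<Rightarrow> 'a tensor \<Rightarrow> 'a tensor" where
  "kronecker n1 n2 n3 S T i j k =
     S (i div n1) (j div n2) (k div n3) * T (i mod n1) (j mod n2) (k mod n3)"

text \<open>The \<open>m\<close>-th power has dimensions \<open>n1 ^ m\<close>, \<open>n2 ^ m\<close>, \<open>n3 ^ m\<close>.\<close>

primrec kronecker_power :: "nat \<Rightarrow> nat \<Rightarrow> nat \<Rightarrow> 'a::field tensor \<Rightarrow> nat \<Rightarrow> 'a tensor" where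
  "kronecker_power n1 n2 n3 T 0 = (\<lambda>_ _ _. 1)"
| "kronecker_power n1 n2 n3 T (Suc m) = kronecker n1 n2 n3 (kronecker_power n1 n2 n3 T m) T"

definition subrank_root :: "nat \<Rightarrow> nat \<Rightarrow> nat \<Rightarrow> 'a::field tensor \<Rightarrow> nat \<Rightarrow> real" where
  "subrank_root n1 n2 n3 T m =
     root m (real (subrank (n1 ^ m) (n2 ^ m) (n3 ^ m) (kronecker_power n1 n2 n3 T m)))"

definition asymptotic_subrank :: "nat \<Rightarrow> nat \<Rightarrow> nat \<Rightarrow> 'a::field tensor \<Rightarrow> real" where
  "asymptotic_subrank n1 n2 n3 T = lim (subrank_root n1 n2 n3 T)"

end

theory Submission
  imports Defs
begin

text \<open>
  Let \<open>q\<^sub>i\<close> be the largest rank of a linear combination of the slices of \<open>T\<close> along leg \<open>i\<close>. A space of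
  matrices of rank at most \<open>q\<close> vanishes, in suitable bases, outside \<open>2q\<close> rows and \<open>2q\<close> columns; for a concise tensor this
  yields \<open>n\<^sub>3 \<le> 2 q\<^sub>2 (1 + q\<^sub>1)\<close> and its analogues. On the other hand the three matrices of maximal rank
  show that \<open>T\<^sup>\<boxtimes>\<^sup>3\<close> restricts to the matrix multiplication tensor \<open>\<langle>q\<^sub>1, q\<^sub>2, q\<^sub>3\<rangle>\<close>, whose asymptotic subrank
  is at least a quarter of \<open>min (q\<^sub>1 q\<^sub>2) (q\<^sub>1 q\<^sub>3) (q\<^sub>2 q\<^sub>3)\<close> by Strassen's argument. So the cube of the
  asymptotic subrank of \<open>T\<close> is at least \<open>min n\<^sub>i / 16\<close>, and applying this to the powers of \<open>T\<close> removes
  the constant. The limit exists by Fekete's lemma.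
\<close>

section \<open>Spaces of bilinear forms of bounded rank\<close>

lemma homogeneous_system_nontrivial:
  fixes M :: "'b \<Rightarrow> 'c \<Rightarrow> 'a::field"
  assumes "finite A" "finite B" "card A < card B"
  shows "\<exists>c. (\<exists>b\<in>B. c b \<noteq> 0) \<and> (\<forall>a\<in>A. (\<Sum>b\<in>B. c b * M b a) = 0)"
  using assms
proof (induction A arbitrary: B M rule: finite_induct)
  case empty
  then obtain b where "b \<in> B" by (metis card_gt_0_iff card.empty ex_in_conv)
  then show ?case by (intro exI[of _ "\<lambda>_. 1"]) auto
next
  case (insert a A)
  show ?case
  proof (cases "\<forall>b\<in>B. M b a = 0")
    case True
    obtain c where "\<exists>b\<in>B. c b \<noteq> 0" "\<forall>a\<in>A. (\<Sum>b\<in>B. c b * M b a) = 0"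
      using insert.IH[of B M] insert.prems insert.hyps by auto
    then show ?thesis using True by (intro exI[of _ c]) auto
  next
    case False
    then obtain p where p: "p \<in> B" "M p a \<noteq> 0" by blast
    define M' where "M' = (\<lambda>b x. M b x - M b a / M p a * M p x)"
    have "card A < card (B - {p})" using insert.prems insert.hyps p by auto
    then obtain c where c: "\<exists>b\<in>B - {p}. c b \<noteq> 0" "\<forall>x\<in>A. (\<Sum>b\<in>B - {p}. c b * M' b x) = 0"
      using insert.IH[of "B - {p}" M'] insert.prems by auto
    \<comment> \<open>The value of the eliminated unknown that solves equation \<open>a\<close>; the
      reduced system then says that the other equations hold as well.\<close>
    define e where "e = - (\<Sum>b\<in>B - {p}. c b * M b a) / M p a"
    define c' where "c' = c(p := e)"
    have split: "(\<Sum>b\<in>B. c' b * M b x) = e * M p x + (\<Sum>b\<in>B - {p}. c b * M b x)" for x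
    proof -
      have "(\<Sum>b\<in>B. c' b * M b x) = c' p * M p x + (\<Sum>b\<in>B - {p}. c' b * M b x)"
        using insert.prems p by (simp add: sum.remove)
      moreover have "(\<Sum>b\<in>B - {p}. c' b * M b x) = (\<Sum>b\<in>B - {p}. c b * M b x)"
        by (rule sum.cong) (auto simp: c'_def)
      ultimately show ?thesis by (simp add: c'_def)
    qed
    have "(\<Sum>b\<in>B. c' b * M b a) = 0"
      using p unfolding split by (simp add: e_def)
    moreover have "(\<Sum>b\<in>B. c' b * M b x) = 0" if "x \<in> A" for x
    proof -
      have "0 = (\<Sum>b\<in>B - {p}. c b * M b x - c b * M b a * (M p x / M p a))"
        using c(2) that by (simp add: M'_def algebra_simps)
      also have "\<dots> = (\<Sum>b\<in>B - {p}. c b * M b x) - (\<Sum>b\<in>B - {p}. c b * M b a) * (M p x / M p a)"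
        by (simp add: sum_subtractf sum_distrib_right sum_divide_distrib)
      finally show ?thesis unfolding split e_def by simp
    qed
    moreover have "\<exists>b\<in>B. c' b \<noteq> 0" using c(1) by (auto simp: c'_def)
    ultimately show ?thesis by (intro exI[of _ c']) auto
  qed
qed

text \<open>If \<open>C\<close> were too small, some nonzero row vector \<open>x\<close> would be
  killed by the factor \<open>f\<close>, and multiplying by \<open>g\<close> would give
  \<open>x = 0\<close>. Used for upper bounds on lengths of dual families and on the
  subrank.\<close>

lemma identity_factorization_le:
  fixes f :: "nat \<Rightarrow> 'c \<Rightarrow> 'a::field"
  assumes "finite C"
    and "\<And>a b. a < r \<Longrightarrow> b < r \<Longrightarrow> (\<Sum>c\<in>C. f a c * g c b) = (if a = b then 1 else 0)"
  shows "r \<le> card C"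
proof (rule ccontr)
  assume "\<not> r \<le> card C"
  then obtain x where x: "\<exists>a\<in>{..<r}. x a \<noteq> 0" "\<forall>c\<in>C. (\<Sum>a<r. x a * f a c) = 0"
    using homogeneous_system_nontrivial[of C "{..<r}" f] assms(1) by auto
  then obtain b where b: "b < r" "x b \<noteq> 0" by auto
  have "x b = (\<Sum>a<r. x a * (if a = b then 1 else 0))"
    using b by (simp add: if_distrib cong: if_cong)
  also have "\<dots> = (\<Sum>a<r. x a * (\<Sum>c\<in>C. f a c * g c b))"
    using assms(2) b by (intro sum.cong) auto
  also have "\<dots> = (\<Sum>a<r. \<Sum>c\<in>C. x a * f a c * g c b)"
    by (simp add: sum_distrib_left mult.assoc)
  also have "\<dots> = (\<Sum>c\<in>C. (\<Sum>a<r. x a * f a c) * g c b)"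
    by (subst sum.swap) (simp add: sum_distrib_right)
  also have "\<dots> = 0" using x by simp
  finally show False using b by simp
qed

section \<open>Linear and bilinear forms on function spaces\<close>

text \<open>Vectors are functions on an arbitrary index type, so the spaces may be
  infinite-dimensional; finiteness enters through ranks of forms and ranges of finite sums.\<close>

definition linear_form :: "(('i \<Rightarrow> 'a::field) \<Rightarrow> 'a) \<Rightarrow> bool" where
  "linear_form h \<longleftrightarrow> (\<forall>c x y. h (\<lambda>i. c * x i + y i) = c * h x + h y)"

lemma linear_formD: "linear_form h \<Longrightarrow> h (\<lambda>i. c * x i + y i) = c * h x + h y"
  by (simp add: linear_form_def)

lemma linear_form_zero: "linear_form h \<Longrightarrow> h (\<lambda>i. 0) = 0"
  using linear_formD[of h "-1" "\<lambda>i. 0" "\<lambda>i. 0"] by simp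

lemma linear_form_sum:
  assumes "linear_form h" "finite A"
  shows "h (\<lambda>i. \<Sum>a\<in>A. c a * v a i) = (\<Sum>a\<in>A. c a * h (v a))"
  using assms(2)
  by (induction A rule: finite_induct)
     (simp_all add: linear_form_zero[OF assms(1)] linear_formD[OF assms(1)])

lemma linear_form_scale: "linear_form h \<Longrightarrow> h (\<lambda>i. c * x i) = c * h x"
  using linear_formD[of h c x "\<lambda>i. 0"] by (simp add: linear_form_zero)

lemma linear_form_diff_sum:
  assumes "linear_form h" "finite A"
  shows "h (\<lambda>i. x i - (\<Sum>a\<in>A. c a * v a i)) = h x - (\<Sum>a\<in>A. c a * h (v a))"
  using linear_formD[OF assms(1), of "-1" "\<lambda>i. \<Sum>a\<in>A. c a * v a i" x]
  by (simp add: linear_form_sum[OF assms])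

definition bilinear_form :: "(('i \<Rightarrow> 'a::field) \<Rightarrow> ('j \<Rightarrow> 'a) \<Rightarrow> 'a) \<Rightarrow> bool" where
  "bilinear_form b \<longleftrightarrow> (\<forall>y. linear_form (\<lambda>x. b x y)) \<and> (\<forall>x. linear_form (b x))"

lemma bilinear_formD:
  assumes "bilinear_form b"
  shows "linear_form (\<lambda>x. b x y)" "linear_form (b x)"
  using assms by (auto simp: bilinear_form_def)

text \<open>A form of finite rank \<open>q\<close> has dual families of length \<open>r\<close> exactly for \<open>r \<le> q\<close>.\<close>

definition dual_family ::
  "(('i \<Rightarrow> 'a::field) \<Rightarrow> ('j \<Rightarrow> 'a) \<Rightarrow> 'a) \<Rightarrow> nat \<Rightarrow> (nat \<Rightarrow> 'i \<Rightarrow> 'a) \<Rightarrow> (nat \<Rightarrow> 'j \<Rightarrow> 'a) \<Rightarrow> bool"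
  where
  "dual_family b r v w \<longleftrightarrow> (\<forall>a<r. \<forall>c<r. b (v a) (w c) = (if a = c then 1 else 0))"

definition form_rank_le :: "(('i \<Rightarrow> 'a::field) \<Rightarrow> ('j \<Rightarrow> 'a) \<Rightarrow> 'a) \<Rightarrow> nat \<Rightarrow> bool" where
  "form_rank_le b q \<longleftrightarrow> (\<forall>r v w. dual_family b r v w \<longrightarrow> r \<le> q)"

lemma form_rank_leD: "form_rank_le b q \<Longrightarrow> dual_family b r v w \<Longrightarrow> r \<le> q"
  by (auto simp: form_rank_le_def)

lemma dual_family_swap: "dual_family (\<lambda>x y. b y x) r v w \<longleftrightarrow> dual_family b r w v"
  by (auto simp: dual_family_def)

text \<open>Gram-Schmidt for a bilinear form: as long as the family does not reproduce
  \<open>b\<close>, the residue at some \<open>x\<close>, \<open>y\<close> yields one further dual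
  pair, and the rank bound stops this. The first \<open>s\<close> members stay unchanged, so that
  two forms can be expanded over a common initial family.\<close>

lemma extend_dual_family:
  assumes bil: "bilinear_form b"
    and "dual_family b s v w"
    and bound: "form_rank_le b q"
  shows "\<exists>r v' w'. s \<le> r \<and> r \<le> q \<and> (\<forall>a<s. v' a = v a \<and> w' a = w a) \<and>
    (\<forall>x y. b x y = (\<Sum>a<r. b x (w' a) * b (v' a) y))"
  using assms(2)
proof (induction "q - s" arbitrary: s v w rule: less_induct)
  case less
  note dual = less.prems[unfolded dual_family_def, rule_format]
  have sq: "s \<le> q" using form_rank_leD[OF bound less.prems] .
  show ?case
  proof (cases "\<forall>x y. b x y = (\<Sum>a<s. b x (w a) * b (v a) y)")
    case True
    then show ?thesis using sq by blast
  next
    case False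
    then obtain x y where xy: "b x y \<noteq> (\<Sum>a<s. b x (w a) * b (v a) y)" by blast
    define d where "d = b x y - (\<Sum>a<s. b x (w a) * b (v a) y)"
    have d: "d \<noteq> 0" using xy by (simp add: d_def)
    \<comment> \<open>Removing the components along the family makes \<open>x'\<close> and
      \<open>y'\<close> orthogonal to it with respect to \<open>b\<close>. The two pair to the
      residue \<open>d\<close>, which the factor \<open>inverse d\<close> scales to 1.\<close>
    define x' where "x' = (\<lambda>i. x i - (\<Sum>a<s. b x (w a) * v a i))"
    define y' where "y' = (\<lambda>i. y i - (\<Sum>a<s. b (v a) y * w a i))"
    define y'' where "y'' = (\<lambda>i. inverse d * y' i)"
    have bx': "b x' z = b x z - (\<Sum>a<s. b x (w a) * b (v a) z)" for z
      unfolding x'_def by (rule linear_form_diff_sum[OF bilinear_formD(1)[OF bil]]) simp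
    have by': "b z y' = b z y - (\<Sum>a<s. b (v a) y * b z (w a))" for z
      unfolding y'_def by (rule linear_form_diff_sum[OF bilinear_formD(2)[OF bil]]) simp
    have by'': "b z y'' = inverse d * b z y'" for z
      unfolding y''_def by (rule linear_form_scale[OF bilinear_formD(2)[OF bil]])
    have x'w: "b x' (w c) = 0" if "c < s" for c
    proof -
      have "(\<Sum>a<s. b x (w a) * b (v a) (w c)) = (\<Sum>a<s. if a = c then b x (w a) else 0)"
        using dual that by (intro sum.cong) auto
      then show ?thesis using that by (simp add: bx')
    qed
    have vy': "b (v c) y' = 0" if "c < s" for c
    proof -
      have "(\<Sum>a<s. b (v a) y * b (v c) (w a)) = (\<Sum>a<s. if c = a then b (v a) y else 0)"
        using dual that by (intro sum.cong) auto
      then show ?thesis using that by (simp add: by')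
    qed
    have "b x' y' = d"
      using x'w by (simp add: by' bx'[of y] d_def)
    then have x'y'': "b x' y'' = 1" using d by (simp add: by'')
    have dual': "dual_family b (Suc s) (v(s := x')) (w(s := y''))"
      unfolding dual_family_def using dual x'w vy' x'y'' by (auto simp: less_Suc_eq by'')
    then have "Suc s \<le> q" by (rule form_rank_leD[OF bound])
    then have "q - Suc s < q - s" by simp
    from less.hyps[OF this dual'] obtain r v' w' where
      r: "Suc s \<le> r" "r \<le> q" "\<forall>a<Suc s. v' a = (v(s := x')) a \<and> w' a = (w(s := y'')) a"
      "\<forall>x y. b x y = (\<Sum>a<r. b x (w' a) * b (v' a) y)" by blast
    have "\<forall>a<s. v' a = v a \<and> w' a = w a" using r(3) by simp
    then show ?thesis using Suc_leD[OF r(1)] r(2,4) by blast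
  qed
qed

text \<open>Over a large field a generic combination of \<open>M\<close> and \<open>N\<close> gives \<open>s = 0\<close>; the weaker bound holds over
  every field. Indeed \<open>M\<close> is the difference of \<open>M + N\<close> and \<open>N\<close>, and after splitting off the common
  part carried by \<open>v\<close>, \<open>w\<close> each of these has rank at most \<open>q - s\<close>.\<close>

lemma dual_family_halving:
  fixes M N :: "('i \<Rightarrow> 'a::field) \<Rightarrow> ('j \<Rightarrow> 'a) \<Rightarrow> 'a"
  assumes M: "dual_family M q vM wM"
    and bilM: "bilinear_form M"
    and bilN: "bilinear_form N"
    and rankN: "form_rank_le N q"
    and rankMN: "form_rank_le (\<lambda>x y. M x y + N x y) q"
    and dual: "dual_family N s v w"
    and Mv: "\<And>a y. a < s \<Longrightarrow> M (v a) y = 0"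
    and Mw: "\<And>a x. a < s \<Longrightarrow> M x (w a) = 0"
  shows "2 * s \<le> q"
proof -
  define MN where "MN = (\<lambda>x y. M x y + N x y)"
  have bilMN: "bilinear_form MN"
    using bilM bilN by (simp add: MN_def bilinear_form_def linear_form_def algebra_simps)
  have dualMN: "dual_family MN s v w"
    using dual Mv by (auto simp: dual_family_def MN_def)
  from extend_dual_family[OF bilN dual rankN] obtain r1 v1 w1 where
    r1: "s \<le> r1" "r1 \<le> q" "\<forall>a<s. v1 a = v a \<and> w1 a = w a"
      "\<And>x y. N x y = (\<Sum>a<r1. N x (w1 a) * N (v1 a) y)" by blast
  from extend_dual_family[OF bilMN dualMN rankMN[folded MN_def]] obtain r2 v2 w2 where
    r2: "s \<le> r2" "r2 \<le> q" "\<forall>a<s. v2 a = v a \<and> w2 a = w a"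
      "\<And>x y. MN x y = (\<Sum>a<r2. MN x (w2 a) * MN (v2 a) y)" by blast
  \<comment> \<open>\<open>M\<close> vanishes on \<open>v\<close> and on \<open>w\<close>, so the
    first \<open>s\<close> terms of both expansions coincide and cancel in
    \<open>MN - N\<close>.\<close>
  define common where "common = (\<lambda>x y. \<Sum>a<s. N x (w a) * N (v a) y)"
  have split: "(\<Sum>a<r. F a) = (\<Sum>a<s. F a) + (\<Sum>a=s..<r. F a)" if "s \<le> r" for r and F :: "nat \<Rightarrow> 'a"
    using sum.atLeastLessThan_concat[of 0 s r F] that by (simp add: lessThan_atLeast0)
  have N: "N x y = common x y + (\<Sum>a=s..<r1. N x (w1 a) * N (v1 a) y)" for x y
    unfolding r1(4)[of x y] split[OF r1(1)] common_def using r1(3) by simp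
  have MN: "MN x y = common x y + (\<Sum>a=s..<r2. MN x (w2 a) * MN (v2 a) y)" for x y
  proof -
    have "(\<Sum>a<s. MN x (w2 a) * MN (v2 a) y) = common x y"
      unfolding common_def using r2(3) Mv Mw by (intro sum.cong) (auto simp: MN_def)
    then show ?thesis unfolding r2(4)[of x y] split[OF r2(1)] by simp
  qed
  \<comment> \<open>What remains of \<open>M\<close> is a sum of \<open>(r2 - s) + (r1 - s)\<close>
    products of linear forms; sampled on the dual family of \<open>M\<close>, it factors the
    identity of size \<open>q\<close> through \<open>C\<close>.\<close>
  define C where "C = {s..<r2} <+> {s..<r1}"
  define f where "f = (\<lambda>a c. case c of Inl c \<Rightarrow> MN (vM a) (w2 c) | Inr c \<Rightarrow> - N (vM a) (w1 c))"
  define g where "g = (\<lambda>c b. case c of Inl c \<Rightarrow> MN (v2 c) (wM b) | Inr c \<Rightarrow> N (v1 c) (wM b))"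
  have "(\<Sum>c\<in>C. f a c * g c b) = M (vM a) (wM b)" for a b
  proof -
    have "(\<Sum>c\<in>C. f a c * g c b) = MN (vM a) (wM b) - N (vM a) (wM b)"
      unfolding C_def
      by (simp add: sum.Plus MN[of "vM a" "wM b"] N[of "vM a" "wM b"] f_def g_def sum_negf)
    then show ?thesis by (simp add: MN_def)
  qed
  then have "q \<le> card C"
    using M by (intro identity_factorization_le[of C q f g]) (auto simp: C_def dual_family_def)
  also have "card C = (r2 - s) + (r1 - s)" by (simp add: C_def card_Plus)
  finally show ?thesis using r1 r2 by linarith
qed

section \<open>Compression of spaces of bounded rank\<close>

text \<open>Halving drives the induction. A member \<open>M\<close> of rank \<open>q\<close> is
  split off by projecting onto its two kernels, where all projected forms have rank at most
  \<open>q div 2\<close>. This takes \<open>q\<close> conditions of each kind for \<open>M\<close>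
  and \<open>2 * (q div 2) \<le> q\<close> for the rest. The same \<open>h\<close> and
  \<open>\<beta>\<close> serve all of \<open>\<B>\<close>.\<close>

lemma bounded_rank_compression:
  fixes \<B> :: "(('i \<Rightarrow> 'a::field) \<Rightarrow> ('j \<Rightarrow> 'a) \<Rightarrow> 'a) set"
  assumes "\<And>b. b \<in> \<B> \<Longrightarrow> bilinear_form b"
    and "\<And>b b'. b \<in> \<B> \<Longrightarrow> b' \<in> \<B> \<Longrightarrow> (\<lambda>x y. b x y + b' x y) \<in> \<B>"
    and "\<And>b. b \<in> \<B> \<Longrightarrow> form_rank_le b q"
  shows "\<exists>h \<beta>. (\<forall>l. linear_form (h l)) \<and>
    (\<forall>b\<in>\<B>. \<forall>y. (\<forall>l<2*q. h l y = 0 \<and> b (\<beta> l) y = 0) \<longrightarrow> (\<forall>x. b x y = 0))"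
  using assms
proof (induction q arbitrary: \<B> rule: less_induct)
  case (less q)
  note bil = less.prems(1) and add = less.prems(2) and rank = less.prems(3)
  have lin0: "linear_form (\<lambda>y::'j \<Rightarrow> 'a. 0)" by (simp add: linear_form_def)
  show ?case
  proof (cases "q > 0 \<and> (\<exists>M\<in>\<B>. \<exists>v w. dual_family M q v w)")
    \<comment> \<open>For \<open>q = 0\<close> all forms vanish. If \<open>q > 0\<close> is not
      attained, the bound drops to \<open>q - 1\<close>, and the data found there also serve for
      \<open>q\<close>.\<close>
    case False
    show ?thesis
    proof (cases "q = 0")
      case True
      have "b x y = 0" if "b \<in> \<B>" for b x y
        using extend_dual_family[OF bil[OF that], of 0 _ _ 0] rank[OF that] True
        by (force simp: dual_family_def)
      then show ?thesis using lin0 by (intro exI[of _ "\<lambda>_ _. 0"]) auto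
    next
      case q: False
      have rank': "form_rank_le b (q - 1)" if b: "b \<in> \<B>" for b
        unfolding form_rank_le_def
      proof (intro allI impI)
        fix r v w assume dual: "dual_family b r v w"
        then have "r \<noteq> q" using False q b by blast
        then show "r \<le> q - 1" using form_rank_leD[OF rank[OF b] dual] by simp
      qed
      have "q - 1 < q" using q by simp
      from less.IH[OF this bil add rank'] obtain h \<beta> where
        h: "\<forall>l. linear_form (h l)" and
        b: "\<forall>b\<in>\<B>. \<forall>y. (\<forall>l<2*(q-1). h l y = 0 \<and> b (\<beta> l) y = 0) \<longrightarrow> (\<forall>x. b x y = 0)"
        by blast
      have le: "2 * (q - 1) \<le> 2 * q" by simp
      show ?thesis
        by (intro exI[of _ h] exI[of _ \<beta>] conjI) (use h b order.strict_trans2[OF _ le] in blast)+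
    qed
  next
    case True
    then obtain M v w where M: "M \<in> \<B>" "dual_family M q v w" and q: "q > 0" by blast
    note bilM = bil[OF M(1)]
    from extend_dual_family[OF bilM M(2) rank[OF M(1)]]
    obtain r v' w' where "q \<le> r" "r \<le> q" and eq: "\<forall>a<q. v' a = v a \<and> w' a = w a"
      and rep': "\<forall>x y. M x y = (\<Sum>a<r. M x (w' a) * M (v' a) y)" by blast
    then have "r = q" by simp
    then have rep: "M x y = (\<Sum>a<q. M x (w a) * M (v a) y)" for x y
      using eq rep'[rule_format, of x y] by simp
    \<comment> \<open>\<open>p\<close> and \<open>p'\<close> project onto the left and right kernels
      of \<open>M\<close> along the spans of \<open>v\<close> and \<open>w\<close>.\<close>
    define p where "p = (\<lambda>x i. x i - (\<Sum>a<q. M x (w a) * v a i))"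
    define p' where "p' = (\<lambda>y i. y i - (\<Sum>a<q. M (v a) y * w a i))"
    have lin_p: "linear_form (\<lambda>x. h (p x))" if "linear_form h" for h
    proof -
      have p: "p (\<lambda>i. c * x i + y i) = (\<lambda>i. c * p x i + p y i)" for c x y
        unfolding p_def linear_formD[OF bilinear_formD(1)[OF bilM]]
        by (rule ext) (simp add: ring_distribs sum.distrib sum_distrib_left mult.assoc)
      show ?thesis unfolding linear_form_def p using linear_formD[OF that] by blast
    qed
    have lin_p': "linear_form (\<lambda>y. h (p' y))" if "linear_form h" for h
    proof -
      have p': "p' (\<lambda>i. c * x i + y i) = (\<lambda>i. c * p' x i + p' y i)" for c x y
        unfolding p'_def linear_formD[OF bilinear_formD(2)[OF bilM]]
        by (rule ext) (simp add: ring_distribs sum.distrib sum_distrib_left mult.assoc)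
      show ?thesis unfolding linear_form_def p' using linear_formD[OF that] by blast
    qed
    have Mp: "M (p x) y = 0" for x y
      using linear_form_diff_sum[OF bilinear_formD(1)[OF bilM], where A="{..<q}" and x=x and c="\<lambda>a. M x (w a)" and v=v]
      by (simp add: p_def rep[of x y])
    have Mp': "M x (p' y) = 0" for x y
      using linear_form_diff_sum[OF bilinear_formD(2)[OF bilM], where A="{..<q}" and x=y and c="\<lambda>a. M (v a) y" and v=w]
      by (simp add: p'_def rep[of x y] mult.commute)
    define \<B>' where "\<B>' = (\<lambda>N x y. N (p x) (p' y)) ` \<B>"
    have bil': "bilinear_form b" if "b \<in> \<B>'" for b
      using that bil lin_p lin_p' unfolding \<B>'_def bilinear_form_def by auto
    have add': "(\<lambda>x y. b x y + b' x y) \<in> \<B>'" if "b \<in> \<B>'" "b' \<in> \<B>'" for b b'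
    proof -
      from that obtain N N' where N: "N \<in> \<B>" "N' \<in> \<B>"
        "b = (\<lambda>x y. N (p x) (p' y))" "b' = (\<lambda>x y. N' (p x) (p' y))" by (auto simp: \<B>'_def)
      show ?thesis unfolding \<B>'_def
        by (rule image_eqI[OF _ add[OF N(1,2)]]) (simp add: N)
    qed
    have rank': "form_rank_le b (q div 2)" if b: "b \<in> \<B>'" for b
      unfolding form_rank_le_def
    proof (intro allI impI)
      fix r v' w' assume dual: "dual_family b r v' w'"
      from b obtain N where N: "N \<in> \<B>" "b = (\<lambda>x y. N (p x) (p' y))" by (auto simp: \<B>'_def)
      have "2 * r \<le> q"
      proof (rule dual_family_halving[OF M(2) bilM bil[OF N(1)] rank[OF N(1)]])
        show "dual_family N r (\<lambda>a. p (v' a)) (\<lambda>a. p' (w' a))"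
          using dual by (simp add: N dual_family_def)
      qed (use rank[OF add[OF M(1) N(1)]] Mp Mp' in auto)
      then show "r \<le> q div 2" by simp
    qed
    have "q div 2 < q" using q by simp
    from less.IH[OF this bil' add' rank'] obtain h \<beta> where h: "\<forall>l. linear_form (h l)" and
      "\<forall>b\<in>\<B>'. \<forall>y. (\<forall>l<2*(q div 2). h l y = 0 \<and> b (\<beta> l) y = 0) \<longrightarrow> (\<forall>x. b x y = 0)"
      by blast
    then have b': "(\<And>l. l < 2*(q div 2) \<Longrightarrow> h l y = 0 \<and> b (\<beta> l) y = 0) \<Longrightarrow> b x y = 0"
      if "b \<in> \<B>'" for b x y
      using that by simp
    \<comment> \<open>The first \<open>q\<close> forms test whether \<open>y\<close> lies in the
      right kernel of \<open>M\<close>, where \<open>p'\<close> acts as the identity; the first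
      \<open>q\<close> vectors control the part of \<open>x\<close> that \<open>p\<close>
      removes.\<close>
    define H where "H = (\<lambda>l. if l < q then M (v l) else h (l - q))"
    define \<beta>' where "\<beta>' = (\<lambda>l. if l < q then v l else p (\<beta> (l - q)))"
    have "N x y = 0" if N: "N \<in> \<B>" and y: "\<And>l. l < 2 * q \<Longrightarrow> H l y = 0 \<and> N (\<beta>' l) y = 0" for N x y
    proof -
      have My: "M (v a) y = 0" and Ny: "N (v a) y = 0" if "a < q" for a
        using y[of a] that by (auto simp: H_def \<beta>'_def)
      have p'y: "p' y = y" using My by (simp add: p'_def)
      have "N (p x) (p' y) = 0"
      proof (rule b'[of "\<lambda>x y. N (p x) (p' y)"])
        show "(\<lambda>x y. N (p x) (p' y)) \<in> \<B>'" using N by (auto simp: \<B>'_def)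
        show "h l y = 0 \<and> N (p (\<beta> l)) (p' y) = 0" if "l < 2 * (q div 2)" for l
        proof -
          have "q + l < 2 * q" using that by linarith
          from y[OF this] show ?thesis by (simp add: H_def \<beta>'_def p'y)
        qed
      qed
      moreover have "N (p x) y = N x y - (\<Sum>a<q. M x (w a) * N (v a) y)"
        unfolding p_def by (rule linear_form_diff_sum[OF bilinear_formD(1)[OF bil[OF N]]]) simp
      ultimately show ?thesis by (simp add: p'y Ny)
    qed
    moreover have "linear_form (H l)" for l
      using h bilinear_formD(2)[OF bilM] by (simp add: H_def)
    ultimately show ?thesis by blast
  qed
qed

text \<open>Compress the space of forms \<open>t x\<close>. For each of the resulting
  \<open>2 * q1\<close> vectors \<open>\<beta> l\<close>, vanishing of
  \<open>t x (\<beta> l) z\<close> for all \<open>x\<close> amounts to \<open>q2\<close> linear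
  conditions on \<open>z\<close>, because the slice at \<open>\<beta> l\<close> has rank at most
  \<open>q2\<close>. So \<open>2 * q1 + 2 * q1 * q2\<close> equations force \<open>z\<close> into
  the kernel of \<open>t\<close>; with more unknowns they would have a nonzero solution.\<close>

lemma dim_le_slice_ranks:
  fixes t :: "('i \<Rightarrow> 'a::field) \<Rightarrow> ('j \<Rightarrow> 'a) \<Rightarrow> (nat \<Rightarrow> 'a) \<Rightarrow> 'a"
  assumes lin1: "\<And>y z. linear_form (\<lambda>x. t x y z)"
    and lin2: "\<And>x z. linear_form (\<lambda>y. t x y z)"
    and lin3: "\<And>x y. linear_form (t x y)"
    and rank1: "\<And>x. form_rank_le (t x) q1"
    and rank2: "\<And>y. form_rank_le (\<lambda>x. t x y) q2"
    and nondeg: "\<And>z. (\<And>x y. t x y z = 0) \<Longrightarrow> \<forall>k<n. z k = 0"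
  shows "n \<le> 2 * q1 * (1 + q2)"
proof (rule ccontr)
  assume big: "\<not> n \<le> 2 * q1 * (1 + q2)"
  have add: "(\<lambda>y z. b y z + b' y z) \<in> range t" if "b \<in> range t" "b' \<in> range t" for b b'
  proof -
    from that obtain x x' where "b = t x" "b' = t x'" by auto
    then have "(\<lambda>y z. b y z + b' y z) = t (\<lambda>i. 1 * x i + x' i)"
      by (intro ext) (subst linear_formD[OF lin1], simp)
    then show ?thesis by auto
  qed
  have bil: "bilinear_form b" if "b \<in> range t" for b
    using that lin2 lin3 by (auto simp: bilinear_form_def)
  have rank: "form_rank_le b q1" if "b \<in> range t" for b
    using that rank1 by auto
  from bounded_rank_compression[OF bil add rank] obtain h \<beta> where h: "\<And>l. linear_form (h l)" and
    "\<forall>b\<in>range t. \<forall>z. (\<forall>l<2*q1. h l z = 0 \<and> b (\<beta> l) z = 0) \<longrightarrow> (\<forall>y. b y z = 0)"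
    by blast
  then have compress: "(\<And>l. l < 2 * q1 \<Longrightarrow> h l z = 0 \<and> t x (\<beta> l) z = 0) \<Longrightarrow> t x y z = 0" for x y z
    by simp
  \<comment> \<open>A rank factorization of the slice at \<open>y\<close> provides the test vectors;
    it may be shorter than \<open>q2\<close>, and surplus vectors only add conditions.\<close>
  have "\<forall>y. \<exists>v. \<forall>z. (\<forall>a<q2. t (v a) y z = 0) \<longrightarrow> (\<forall>x. t x y z = 0)"
  proof
    fix y
    have "bilinear_form (\<lambda>x. t x y)" using lin1 lin3 by (auto simp: bilinear_form_def)
    from extend_dual_family[OF this _ rank2, of 0] obtain r v w where
      r: "r \<le> q2" "\<forall>x z. t x y z = (\<Sum>a<r. t x y (w a) * t (v a) y z)"
      by (auto simp: dual_family_def)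
    have "t x y z = 0" if "\<forall>a<q2. t (v a) y z = 0" for x z
      using r(2)[rule_format, of x z] r(1) that by simp
    then show "\<exists>v. \<forall>z. (\<forall>a<q2. t (v a) y z = 0) \<longrightarrow> (\<forall>x. t x y z = 0)" by blast
  qed
  from choice[OF this] obtain v where
    "\<forall>y z. (\<forall>a<q2. t (v y a) y z = 0) \<longrightarrow> (\<forall>x. t x y z = 0)" by (rule exE)
  then have v: "(\<And>a. a < q2 \<Longrightarrow> t (v y a) y z = 0) \<Longrightarrow> t x y z = 0" for x y z by simp
  define C where "C = {..<2 * q1} <+> ({..<2 * q1} \<times> {..<q2})"
  define \<phi> where "\<phi> = (\<lambda>c. case c of Inl l \<Rightarrow> h l | Inr (l, a) \<Rightarrow> t (v (\<beta> l) a) (\<beta> l))"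
  define e where "e = (\<lambda>k i. if i = (k::nat) then 1 else 0 :: 'a)"
  have lin: "linear_form (\<phi> c)" for c
    using h lin3 by (auto simp: \<phi>_def split: sum.split)
  have "card C < card {..<n}" using big by (simp add: C_def card_Plus)
  then obtain c where c: "\<exists>k\<in>{..<n}. c k \<noteq> 0" "\<forall>a\<in>C. (\<Sum>k<n. c k * \<phi> a (e k)) = 0"
    using homogeneous_system_nontrivial[of C "{..<n}" "\<lambda>k a. \<phi> a (e k)"] by (auto simp: C_def)
  define z where "z = (\<lambda>i. \<Sum>k<n. c k * e k i)"
  have z: "z k = c k" if "k < n" for k
    using that by (simp add: z_def e_def if_distrib cong: if_cong)
  have \<phi>z: "\<phi> a z = 0" if "a \<in> C" for a
    unfolding z_def using linear_form_sum[OF lin[of a], of "{..<n}" c e] c that by simp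
  have "t x y z = 0" for x y
  proof (rule compress)
    fix l assume l: "l < 2 * q1"
    then have "Inl l \<in> C" unfolding C_def by (intro InlI) simp
    from \<phi>z[OF this] have "h l z = 0" by (simp add: \<phi>_def)
    moreover have "t x (\<beta> l) z = 0"
    proof (rule v)
      fix a assume "a < q2"
      then have "Inr (l, a) \<in> C" unfolding C_def using l by (intro InrI) simp
      from \<phi>z[OF this] show "t (v (\<beta> l) a) (\<beta> l) z = 0" by (simp add: \<phi>_def)
    qed
    ultimately show "h l z = 0 \<and> t x (\<beta> l) z = 0" by blast
  qed
  then show False using nondeg[of z] c(1) z by auto
qed

section \<open>Subrank and Kronecker powers\<close>

text \<open>The rank is the size of a maximal independent set of columns. With \<open>n\<close>
  members it is a basis, so each unit vector is a combination of columns, and \<open>z\<close> is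
  orthogonal to all columns.\<close>

lemma (in vec_space) full_row_rank_left_kernel:
  assumes A: "A \<in> carrier_mat n m"
    and rank: "rank A = n"
    and z: "\<And>c. c < m \<Longrightarrow> (\<Sum>k<n. z k * A $$ (k, c)) = 0"
    and k: "k < n"
  shows "z k = 0"
proof -
  have cols: "set (cols A) \<subseteq> carrier_vec n" using A cols_dim by blast
  have "\<exists>U. finite U \<and> maximal U (\<lambda>T. T \<subseteq> set (cols A) \<and> lin_indpt T) \<and> {} \<subseteq> U"
    by (rule maximal_exists_superset[of "set (cols A)"]) (auto simp: finite_lin_indpt2)
  then obtain U where "finite U" and max: "maximal U (\<lambda>T. T \<subseteq> set (cols A) \<and> lin_indpt T)"
    by blast
  then have U: "U \<subseteq> set (cols A)" "lin_indpt U" by (auto simp: maximal_def)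
  have "card U = n" using rank_card_indpt[OF A max] rank by simp
  then have "basis U"
    using U cols \<open>finite U\<close> by (intro dim_li_is_basis) (auto simp only: dim_is_n fin_dim module_vec_simps)
  then have "span U = carrier_vec n" by (auto simp: basis_def)
  moreover have "unit_vec n k \<in> carrier_vec n" by simp
  ultimately obtain a X where X: "unit_vec n k = lincomb a X" "finite X" "X \<subseteq> U"
    using in_spanE by metis
  then have X': "X \<subseteq> set (cols A)" "X \<subseteq> carrier_vec n" using U cols by auto
  have orth: "(\<Sum>i<n. z i * x $ i) = 0" if "x \<in> X" for x
  proof -
    from that X'(1) have "x \<in> set (cols A)" by blast
    then obtain c where c: "c < m" "x = col A c" using A by (auto simp: cols_def)
    then show ?thesis using z[of c] A by simp
  qed
  have "z k = (\<Sum>i<n. z i * unit_vec n k $ i)"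
    using k by (simp add: unit_vec_def if_distrib cong: if_cong)
  also have "\<dots> = (\<Sum>i<n. z i * (\<Sum>x\<in>X. a x * x $ i))"
    unfolding X(1) using X' by (simp add: lincomb_index)
  also have "\<dots> = (\<Sum>i<n. \<Sum>x\<in>X. a x * (z i * x $ i))"
    by (simp add: sum_distrib_left algebra_simps)
  also have "\<dots> = (\<Sum>x\<in>X. a x * (\<Sum>i<n. z i * x $ i))"
    by (subst sum.swap) (simp add: sum_distrib_left)
  finally show ?thesis using orth by simp
qed

section \<open>Trilinear forms of tensors and the subrank\<close>

text \<open>The trilinear form of \<open>T\<close>. An entry of \<open>apply_maps\<close> is its
  value at one row of each matrix, so restrictions can be described by families of vectors.\<close>

definition contract ::
  "nat \<Rightarrow> nat \<Rightarrow> nat \<Rightarrow> 'a::field tensor \<Rightarrow> (nat \<Rightarrow> 'a) \<Rightarrow> (nat \<Rightarrow> 'a) \<Rightarrow> (nat \<Rightarrow> 'a) \<Rightarrow> 'a" where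
  "contract n1 n2 n3 T u v w = (\<Sum>i<n1. \<Sum>j<n2. \<Sum>k<n3. u i * v j * w k * T i j k)"

text \<open>Together with the swap of the last two legs this generates all permutations of the legs,
  so that facts shown for the last leg carry over to the others.\<close>

lemma contract_rotate:
  "contract n1 n2 n3 T u v w = contract n2 n3 n1 (\<lambda>j k i. T i j k) v w u"
proof -
  have "contract n1 n2 n3 T u v w = (\<Sum>j<n2. \<Sum>i<n1. \<Sum>k<n3. u i * v j * w k * T i j k)"
    unfolding contract_def by (rule sum.swap)
  also have "\<dots> = (\<Sum>j<n2. \<Sum>k<n3. \<Sum>i<n1. u i * v j * w k * T i j k)"
    by (intro sum.cong refl sum.swap)
  finally show ?thesis by (simp add: contract_def mult_ac)
qed

lemma contract_swap:
  "contract n1 n2 n3 T u v w = contract n1 n3 n2 (\<lambda>i k j. T i j k) u w v"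
proof -
  have "contract n1 n2 n3 T u v w = (\<Sum>i<n1. \<Sum>k<n3. \<Sum>j<n2. u i * v j * w k * T i j k)"
    unfolding contract_def by (intro sum.cong refl sum.swap)
  then show ?thesis by (simp add: contract_def mult_ac)
qed

lemma linear_form_contract3: "linear_form (contract n1 n2 n3 T u v)"
  unfolding linear_form_def contract_def
  by (simp add: ring_distribs sum.distrib sum_distrib_left mult_ac)

lemma linear_form_contract2: "linear_form (\<lambda>v. contract n1 n2 n3 T u v w)"
  by (subst contract_swap) (rule linear_form_contract3)

lemma linear_form_contract1: "linear_form (\<lambda>u. contract n1 n2 n3 T u v w)"
  by (subst contract_rotate) (rule linear_form_contract3)

definition kron_vec :: "nat \<Rightarrow> (nat \<Rightarrow> 'a::field) \<Rightarrow> (nat \<Rightarrow> 'a) \<Rightarrow> nat \<Rightarrow> 'a" where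
  "kron_vec n u v i = u (i div n) * v (i mod n)"

lemma contract_cartesian:
  "contract n1 n2 n3 T u v w =
     (\<Sum>(i, j, k)\<in>{..<n1} \<times> {..<n2} \<times> {..<n3}. u i * v j * w k * T i j k)"
  by (simp add: contract_def sum.cartesian_product split_def)

lemma lex_index_less:
  fixes x y m n :: nat
  assumes "x < m" "y < n"
  shows "x * n + y < m * n"
proof -
  have "x * n + y < Suc x * n" using assms by simp
  also have "\<dots> \<le> m * n" using assms by (intro mult_right_mono) auto
  finally show ?thesis .
qed

text \<open>\<open>div\<close> and \<open>mod\<close> give a bijection between lexicographic indices
  and pairs, under which the sum splits into a product of two sums.\<close>

lemma contract_kronecker:
  "contract (m1 * n1) (m2 * n2) (m3 * n3) (kronecker n1 n2 n3 S T)
     (kron_vec n1 u u') (kron_vec n2 v v') (kron_vec n3 w w') =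
   contract m1 m2 m3 S u v w * contract n1 n2 n3 T u' v' w'"
proof -
  define f where "f = (\<lambda>(i, j, k). u i * v j * w k * S i j k)"
  define g where "g = (\<lambda>(i, j, k). u' i * v' j * w' k * T i j k)"
  let ?A = "{..<m1} \<times> {..<m2} \<times> {..<m3}" and ?B = "{..<n1} \<times> {..<n2} \<times> {..<n3}"
  have "contract m1 m2 m3 S u v w * contract n1 n2 n3 T u' v' w' = (\<Sum>p\<in>?A. f p) * (\<Sum>p\<in>?B. g p)"
    by (simp add: contract_cartesian f_def g_def)
  also have "\<dots> = (\<Sum>(p, p')\<in>?A \<times> ?B. f p * g p')"
    by (simp add: sum_product sum.cartesian_product)
  also have "\<dots> = (\<Sum>(i, j, k)\<in>{..<m1*n1} \<times> {..<m2*n2} \<times> {..<m3*n3}.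
      f (i div n1, j div n2, k div n3) * g (i mod n1, j mod n2, k mod n3))"
    by (rule sum.reindex_bij_witness
          [where i = "\<lambda>(i, j, k). ((i div n1, j div n2, k div n3), (i mod n1, j mod n2, k mod n3))"
             and j = "\<lambda>((i, j, k), (i', j', k')). (i * n1 + i', j * n2 + j', k * n3 + k')"])
       (auto simp: less_mult_imp_div_less lex_index_less intro!: mod_less_divisor gr0I)
  also have "\<dots> = contract (m1 * n1) (m2 * n2) (m3 * n3) (kronecker n1 n2 n3 S T)
     (kron_vec n1 u u') (kron_vec n2 v v') (kron_vec n3 w w')"
    unfolding contract_cartesian
    by (intro sum.cong) (auto simp: f_def g_def kron_vec_def kronecker_def mult_ac)
  finally show ?thesis ..
qed

lemma restricts_to_unit_iff:
  "restricts_to_unit n1 n2 n3 T r \<longleftrightarrow>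
     (\<exists>u v w. \<forall>a<r. \<forall>b<r. \<forall>c<r. contract n1 n2 n3 T (u a) (v b) (w c) = unit_tensor a b c)"
proof
  assume "restricts_to_unit n1 n2 n3 T r"
  then obtain A B C where
    "\<forall>a<r. \<forall>b<r. \<forall>c<r. apply_maps n1 n2 n3 A B C T a b c = unit_tensor a b c"
    unfolding restricts_to_unit_def by blast
  then show "\<exists>u v w. \<forall>a<r. \<forall>b<r. \<forall>c<r. contract n1 n2 n3 T (u a) (v b) (w c) = unit_tensor a b c"
    by (intro exI[of _ "\<lambda>a i. A $$ (a, i)"] exI[of _ "\<lambda>a i. B $$ (a, i)"] exI[of _ "\<lambda>a i. C $$ (a, i)"])
       (simp add: apply_maps_def contract_def)
next
  assume "\<exists>u v w. \<forall>a<r. \<forall>b<r. \<forall>c<r. contract n1 n2 n3 T (u a) (v b) (w c) = unit_tensor a b c"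
  then obtain u v w where
    uvw: "\<forall>a<r. \<forall>b<r. \<forall>c<r. contract n1 n2 n3 T (u a) (v b) (w c) = unit_tensor a b c"
    by blast
  have "apply_maps n1 n2 n3 (mat r n1 (\<lambda>(a, i). u a i)) (mat r n2 (\<lambda>(a, i). v a i))
      (mat r n3 (\<lambda>(a, i). w a i)) T a b c = unit_tensor a b c"
    if "a < r" "b < r" "c < r" for a b c
  proof -
    have "apply_maps n1 n2 n3 (mat r n1 (\<lambda>(a, i). u a i)) (mat r n2 (\<lambda>(a, i). v a i))
        (mat r n3 (\<lambda>(a, i). w a i)) T a b c = contract n1 n2 n3 T (u a) (v b) (w c)"
      unfolding apply_maps_def contract_def using that by (intro sum.cong refl) auto
    then show ?thesis using uvw that by simp
  qed
  then show "restricts_to_unit n1 n2 n3 T r"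
    unfolding restricts_to_unit_def
    by (intro bexI[of _ "mat r n1 (\<lambda>(a, i). u a i)"] bexI[of _ "mat r n2 (\<lambda>(a, i). v a i)"]
          bexI[of _ "mat r n3 (\<lambda>(a, i). w a i)"]) auto
qed

text \<open>Setting the last two indices equal turns the unit tensor into the identity matrix of
  size \<open>r\<close>, which factors through \<open>n1\<close> coordinates. The bound makes the
  greatest element in \<open>subrank\<close> exist.\<close>

lemma restricts_to_unit_le:
  assumes "restricts_to_unit n1 n2 n3 T r"
  shows "r \<le> n1"
proof -
  obtain u v w where
    uvw: "\<forall>a<r. \<forall>b<r. \<forall>c<r. contract n1 n2 n3 T (u a) (v b) (w c) = unit_tensor a b c"
    using assms restricts_to_unit_iff by metis
  have "(\<Sum>i<n1. u a i * (\<Sum>j<n2. \<Sum>k<n3. v b j * w b k * T i j k)) = (if a = b then 1 else 0)"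
    if "a < r" "b < r" for a b
    using uvw[rule_format, of a b b] that
    by (simp add: contract_def sum_distrib_left mult.assoc unit_tensor_def)
  then have "r \<le> card {..<n1}" by (intro identity_factorization_le[where f = u
        and g = "\<lambda>i b. \<Sum>j<n2. \<Sum>k<n3. v b j * w b k * T i j k"]) auto
  then show ?thesis by simp
qed

lemma restricts_subrank: "restricts_to_unit n1 n2 n3 T (subrank n1 n2 n3 T)"
  unfolding subrank_def
  by (rule GreatestI_nat[of _ 0 n1]) (simp add: restricts_to_unit_iff, rule restricts_to_unit_le)

lemma le_subrank: "restricts_to_unit n1 n2 n3 T r \<Longrightarrow> r \<le> subrank n1 n2 n3 T"
  unfolding subrank_def by (rule Greatest_le_nat[of _ _ n1]) (auto dest: restricts_to_unit_le)

lemma subrank_le: "subrank n1 n2 n3 T \<le> n1"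
  using restricts_subrank by (rule restricts_to_unit_le)

text \<open>Any finite set may label the unit tensor; below, the labels are pairs or words.\<close>

lemma card_le_subrank:
  assumes "finite S"
    and "\<And>a b c. a \<in> S \<Longrightarrow> b \<in> S \<Longrightarrow> c \<in> S \<Longrightarrow>
      contract n1 n2 n3 T (u a) (v b) (w c) = (if a = b \<and> b = c then 1 else 0)"
  shows "card S \<le> subrank n1 n2 n3 T"
proof -
  obtain h where h: "bij_betw h {0..<card S} S"
    using ex_bij_betw_nat_finite[OF assms(1)] by blast
  then have inS: "h a \<in> S" if "a < card S" for a using that by (auto dest: bij_betwE)
  have inj: "h a = h b \<longleftrightarrow> a = b" if "a < card S" "b < card S" for a b
    using h that by (auto simp: bij_betw_def inj_on_def)
  have "contract n1 n2 n3 T (u (h a)) (v (h b)) (w (h c)) = unit_tensor a b c"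
    if "a < card S" "b < card S" "c < card S" for a b c
    using that by (simp add: assms(2) inS inj unit_tensor_def)
  then have "restricts_to_unit n1 n2 n3 T (card S)"
    unfolding restricts_to_unit_iff
    by (intro exI[of _ "\<lambda>a. u (h a)"] exI[of _ "\<lambda>a. v (h a)"] exI[of _ "\<lambda>a. w (h a)"]) auto
  then show ?thesis by (rule le_subrank)
qed

lemma subrank_kronecker:
  "subrank m1 m2 m3 S * subrank n1 n2 n3 T \<le>
     subrank (m1 * n1) (m2 * n2) (m3 * n3) (kronecker n1 n2 n3 S T)"
proof -
  let ?r = "subrank m1 m2 m3 S" and ?s = "subrank n1 n2 n3 T"
  obtain u v w where 1:
    "\<forall>a<?r. \<forall>b<?r. \<forall>c<?r. contract m1 m2 m3 S (u a) (v b) (w c) = unit_tensor a b c"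
    using restricts_subrank[of m1 m2 m3 S] unfolding restricts_to_unit_iff by blast
  obtain u' v' w' where 2:
    "\<forall>a<?s. \<forall>b<?s. \<forall>c<?s. contract n1 n2 n3 T (u' a) (v' b) (w' c) = unit_tensor a b c"
    using restricts_subrank[of n1 n2 n3 T] unfolding restricts_to_unit_iff by blast
  have "card ({..<?r} \<times> {..<?s}) \<le> subrank (m1 * n1) (m2 * n2) (m3 * n3) (kronecker n1 n2 n3 S T)"
    by (rule card_le_subrank[where u = "\<lambda>(a, b). kron_vec n1 (u a) (u' b)"
          and v = "\<lambda>(a, b). kron_vec n2 (v a) (v' b)" and w = "\<lambda>(a, b). kron_vec n3 (w a) (w' b)"])
       (auto simp: contract_kronecker 1 2 unit_tensor_def split: if_splits)
  then show ?thesis by (simp add: card_cartesian_product)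
qed

text \<open>The recursion appends one factor on the right; regrouping is the associativity of
  lexicographic numbering.\<close>

lemma kronecker_power_add:
  "kronecker_power n1 n2 n3 T (a + b) =
     kronecker (n1 ^ b) (n2 ^ b) (n3 ^ b) (kronecker_power n1 n2 n3 T a) (kronecker_power n1 n2 n3 T b)"
proof (induction b)
  case 0
  show ?case by (simp add: kronecker_def fun_eq_iff)
next
  case (Suc b)
  have div: "i div n div n ^ b = i div (n * n ^ b)" for i n :: nat by (simp add: div_mult2_eq)
  have mod: "i mod (n * n ^ b) div n = i div n mod n ^ b" for i n :: nat
    by (cases "n = 0") (simp_all add: mod_mult2_eq)
  have mod': "i mod (n * n ^ b) mod n = i mod n" for i n :: nat
    by (simp add: mod_mult2_eq)
  show ?case
    by (simp add: Suc.IH kronecker_def fun_eq_iff div mod mod' mult.assoc)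
qed

section \<open>Conciseness under Kronecker powers\<close>

text \<open>Trivial left kernel of the third flattening. In this form conciseness passes to
  Kronecker products without rank computations; the other legs are treated by permuting the
  arguments of \<open>T\<close>.\<close>

definition leg3_nondegenerate :: "nat \<Rightarrow> nat \<Rightarrow> nat \<Rightarrow> 'a::field tensor \<Rightarrow> bool" where
  "leg3_nondegenerate n1 n2 n3 T \<longleftrightarrow>
     (\<forall>z. (\<forall>i<n1. \<forall>j<n2. (\<Sum>k<n3. z k * T i j k) = 0) \<longrightarrow> (\<forall>k<n3. z k = 0))"

lemma sum_div_mod:
  fixes f :: "nat \<Rightarrow> nat \<Rightarrow> 'a::comm_monoid_add"
  shows "(\<Sum>k<m * n. f (k div n) (k mod n)) = (\<Sum>a<m. \<Sum>b<n. f a b)"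
  unfolding sum.cartesian_product
  by (rule sum.reindex_bij_witness[where j = "\<lambda>k. (k div n, k mod n)" and i = "\<lambda>(a, b). a * n + b"])
     (auto simp: less_mult_imp_div_less lex_index_less intro!: mod_less_divisor gr0I)

text \<open>A vector \<open>z\<close> annihilated by the product is read as a matrix
  \<open>y\<close>. For fixed indices of \<open>T\<close>, contracting \<open>y\<close> with
  \<open>T\<close> yields a vector annihilated by \<open>S\<close>, hence zero; so the rows of
  \<open>y\<close> are annihilated by \<open>T\<close>.\<close>

lemma leg3_nondegenerate_kronecker:
  assumes S: "leg3_nondegenerate m1 m2 m3 S" and T: "leg3_nondegenerate n1 n2 n3 T"
  shows "leg3_nondegenerate (m1 * n1) (m2 * n2) (m3 * n3) (kronecker n1 n2 n3 S T)"
  unfolding leg3_nondegenerate_def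
proof (intro allI impI)
  fix z :: "nat \<Rightarrow> 'a" and k
  assume z: "\<forall>i<m1 * n1. \<forall>j<m2 * n2. (\<Sum>k<m3 * n3. z k * kronecker n1 n2 n3 S T i j k) = 0"
    and k: "k < m3 * n3"
  define y where "y = (\<lambda>a b. z (a * n3 + b))"
  have inner: "(\<Sum>b<n3. y a b * T i' j' b) = 0" if ij': "i' < n1" "j' < n2" and a: "a < m3" for i' j' a
  proof -
    have "(\<Sum>a<m3. (\<Sum>b<n3. y a b * T i' j' b) * S i j a) = 0" if "i < m1" "j < m2" for i j
    proof -
      have "0 = (\<Sum>k<m3 * n3. z k * kronecker n1 n2 n3 S T (i * n1 + i') (j * n2 + j') k)"
        using z that ij' by (simp add: lex_index_less)
      also have "\<dots> = (\<Sum>k<m3 * n3. y (k div n3) (k mod n3) * (S i j (k div n3) * T i' j' (k mod n3)))"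
        using ij' by (intro sum.cong refl) (simp add: kronecker_def y_def)
      also have "\<dots> = (\<Sum>a<m3. \<Sum>b<n3. y a b * (S i j a * T i' j' b))"
        by (rule sum_div_mod)
      finally show ?thesis by (simp add: sum_distrib_right sum_distrib_left mult_ac)
    qed
    then show ?thesis
      using S[unfolded leg3_nondegenerate_def, rule_format, of "\<lambda>a. \<Sum>b<n3. y a b * T i' j' b" a] a
      by simp
  qed
  have "k div n3 < m3" using k by (rule less_mult_imp_div_less)
  moreover have "k mod n3 < n3" using k by (intro mod_less_divisor gr0I) auto
  ultimately have "y (k div n3) (k mod n3) = 0"
    using T[unfolded leg3_nondegenerate_def, rule_format, of "y (k div n3)" "k mod n3"] inner by simp
  then show "z k = 0" by (simp add: y_def)
qed

lemma leg3_nondegenerate_power: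
  assumes "leg3_nondegenerate n1 n2 n3 T"
  shows "leg3_nondegenerate (n1 ^ m) (n2 ^ m) (n3 ^ m) (kronecker_power n1 n2 n3 T m)"
proof (induction m)
  case 0
  show ?case by (simp add: leg3_nondegenerate_def)
next
  case (Suc m)
  show ?case
    using leg3_nondegenerate_kronecker[OF Suc assms] by (simp add: mult.commute)
qed

lemma kronecker_power_permute:
  "(\<lambda>j k i. kronecker_power n1 n2 n3 T m i j k) = kronecker_power n2 n3 n1 (\<lambda>j k i. T i j k) m"
  "(\<lambda>i k j. kronecker_power n1 n2 n3 T m i j k) = kronecker_power n1 n3 n2 (\<lambda>i k j. T i j k) m"
  by (induction m) (auto simp: kronecker_def fun_eq_iff)

lemma concise_nondegenerate:
  assumes "concise n1 n2 n3 T"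
  shows "leg3_nondegenerate n1 n2 n3 T" "leg3_nondegenerate n1 n3 n2 (\<lambda>i k j. T i j k)"
    "leg3_nondegenerate n2 n3 n1 (\<lambda>j k i. T i j k)"
proof -
  show "leg3_nondegenerate n1 n2 n3 T"
    unfolding leg3_nondegenerate_def
  proof (intro allI impI)
    fix z k
    assume z: "\<forall>i<n1. \<forall>j<n2. (\<Sum>k<n3. z k * T i j k) = 0" and k: "k < n3"
    show "z k = 0"
    proof (rule vec_space.full_row_rank_left_kernel[OF _ _ _ k])
      show "flattening3 n1 n2 n3 T \<in> carrier_mat n3 (n1 * n2)" by (simp add: flattening3_def)
      show "vec_space.rank n3 (flattening3 n1 n2 n3 T) = n3" using assms by (simp add: concise_def)
      fix c assume c: "c < n1 * n2"
      have "c div n2 < n1" "c mod n2 < n2"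
        using c less_mult_imp_div_less by (auto intro!: mod_less_divisor gr0I)
      then show "(\<Sum>k<n3. z k * flattening3 n1 n2 n3 T $$ (k, c)) = 0"
        using z c by (simp add: flattening3_def)
    qed
  qed
  show "leg3_nondegenerate n1 n3 n2 (\<lambda>i k j. T i j k)"
    unfolding leg3_nondegenerate_def
  proof (intro allI impI)
    fix z k
    assume z: "\<forall>i<n1. \<forall>j<n3. (\<Sum>k<n2. z k * T i k j) = 0" and k: "k < n2"
    show "z k = 0"
    proof (rule vec_space.full_row_rank_left_kernel[OF _ _ _ k])
      show "flattening2 n1 n2 n3 T \<in> carrier_mat n2 (n1 * n3)" by (simp add: flattening2_def)
      show "vec_space.rank n2 (flattening2 n1 n2 n3 T) = n2" using assms by (simp add: concise_def)
      fix c assume c: "c < n1 * n3"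
      have "c div n3 < n1" "c mod n3 < n3"
        using c less_mult_imp_div_less by (auto intro!: mod_less_divisor gr0I)
      then show "(\<Sum>k<n2. z k * flattening2 n1 n2 n3 T $$ (k, c)) = 0"
        using z c by (simp add: flattening2_def)
    qed
  qed
  show "leg3_nondegenerate n2 n3 n1 (\<lambda>j k i. T i j k)"
    unfolding leg3_nondegenerate_def
  proof (intro allI impI)
    fix z k
    assume z: "\<forall>i<n2. \<forall>j<n3. (\<Sum>k<n1. z k * T k i j) = 0" and k: "k < n1"
    show "z k = 0"
    proof (rule vec_space.full_row_rank_left_kernel[OF _ _ _ k])
      show "flattening1 n1 n2 n3 T \<in> carrier_mat n1 (n2 * n3)" by (simp add: flattening1_def)
      show "vec_space.rank n1 (flattening1 n1 n2 n3 T) = n1" using assms by (simp add: concise_def)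
      fix c assume c: "c < n2 * n3"
      have "c div n3 < n2" "c mod n3 < n3"
        using c less_mult_imp_div_less by (auto intro!: mod_less_divisor gr0I)
      then show "(\<Sum>k<n1. z k * flattening1 n1 n2 n3 T $$ (k, c)) = 0"
        using z c by (simp add: flattening1_def)
    qed
  qed
qed

section \<open>Slice ranks and matrix multiplication\<close>

lemma form_rank_le_swap: "form_rank_le (\<lambda>x y. b y x) q \<longleftrightarrow> form_rank_le b q"
  unfolding form_rank_le_def using dual_family_swap by blast

lemma max_rank_attained:
  assumes "\<And>x. form_rank_le (b x) N"
  shows "\<exists>q x v w. dual_family (b x) q v w \<and> (\<forall>x. form_rank_le (b x) q)"
proof -
  let ?P = "\<lambda>q. \<exists>x v w. dual_family (b x) q v w"
  have "?P 0" by (simp add: dual_family_def)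
  moreover have bound: "q \<le> N" if "?P q" for q
    using that assms by (blast dest: form_rank_leD)
  ultimately have "?P (GREATEST q. ?P q)" by (rule GreatestI_nat)
  moreover have "form_rank_le (b x) (GREATEST q. ?P q)" for x
    unfolding form_rank_le_def using Greatest_le_nat[of ?P _ N] bound by blast
  ultimately show ?thesis by blast
qed

text \<open>The slice factors through the \<open>n3\<close> coordinates of the last leg. This crude
  bound makes maximal ranks exist.\<close>

lemma form_rank_le_contract: "form_rank_le (contract n1 n2 n3 T u) n3"
  unfolding form_rank_le_def
proof (intro allI impI)
  fix r v w
  assume dual: "dual_family (contract n1 n2 n3 T u) r v w"
  have "(\<Sum>k<n3. (\<Sum>i<n1. \<Sum>j<n2. u i * v a j * T i j k) * w c k) = contract n1 n2 n3 T u (v a) (w c)"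
    for a c
    by (subst contract_rotate, subst contract_rotate, unfold contract_def)
       (simp add: sum_distrib_left sum_distrib_right mult_ac)
  then have "r \<le> card {..<n3}"
    using dual
    by (intro identity_factorization_le[where f = "\<lambda>a k. \<Sum>i<n1. \<Sum>j<n2. u i * v a j * T i j k"
          and g = "\<lambda>k c. w c k"]) (auto simp: dual_family_def)
  then show "r \<le> n3" by simp
qed

lemma contract_nondegenerate:
  assumes T: "leg3_nondegenerate n1 n2 n3 T"
    and zero: "\<And>u v. contract n1 n2 n3 T u v w = 0"
  shows "\<forall>k<n3. w k = 0"
proof -
  have "(\<Sum>k<n3. w k * T i j k) = 0" if "i < n1" "j < n2" for i j
  proof -
    define e :: "nat \<Rightarrow> nat \<Rightarrow> 'a" where "e = (\<lambda>a b. if b = a then 1 else 0)"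
    have "contract n1 n2 n3 T (e i) (e j) w =
        (\<Sum>i'<n1. e i i' * (\<Sum>j'<n2. e j j' * (\<Sum>k<n3. w k * T i' j' k)))"
      by (simp add: contract_def sum_distrib_left mult_ac)
    also have "\<dots> = (\<Sum>k<n3. w k * T i j k)"
      using that by (simp add: e_def if_distrib[of "\<lambda>c. c * _"] cong: if_cong)
    finally show ?thesis using zero by simp
  qed
  from T[unfolded leg3_nondegenerate_def, rule_format, of w, OF this] show ?thesis by blast
qed

text \<open>\<open>q1\<close>, \<open>q2\<close>, \<open>q3\<close> are chosen as the greatest ranks
  of linear combinations of slices along the three legs. The three inequalities are one estimate
  with the legs permuted.\<close>

lemma slice_families:
  assumes T3: "leg3_nondegenerate n1 n2 n3 T"
    and T2: "leg3_nondegenerate n1 n3 n2 (\<lambda>i k j. T i j k)"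
    and T1: "leg3_nondegenerate n2 n3 n1 (\<lambda>j k i. T i j k)"
  obtains q1 q2 q3 x \<beta>1 \<gamma>1 y \<alpha>2 \<gamma>2 z \<alpha>3 \<beta>3 where
    "dual_family (contract n1 n2 n3 T x) q1 \<beta>1 \<gamma>1"
    "dual_family (\<lambda>u. contract n1 n2 n3 T u y) q2 \<alpha>2 \<gamma>2"
    "dual_family (\<lambda>u v. contract n1 n2 n3 T u v z) q3 \<alpha>3 \<beta>3"
    "n1 \<le> 2 * q3 * (1 + q2)" "n2 \<le> 2 * q1 * (1 + q3)" "n3 \<le> 2 * q2 * (1 + q1)"
proof -
  let ?t = "contract n1 n2 n3 T"
  have "form_rank_le (?t x) n3" for x by (rule form_rank_le_contract)
  from max_rank_attained[of ?t, OF this] obtain q1 x \<beta>1 \<gamma>1 where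
    1: "dual_family (?t x) q1 \<beta>1 \<gamma>1" "\<And>x. form_rank_le (?t x) q1" by blast
  have "form_rank_le (\<lambda>u. ?t u y) n1" for y
  proof -
    have "(\<lambda>u. ?t u y) = (\<lambda>u w. contract n2 n3 n1 (\<lambda>j k i. T i j k) y w u)"
      by (intro ext contract_rotate)
    then show ?thesis by (simp only: form_rank_le_swap[THEN iffD2, OF form_rank_le_contract])
  qed
  from max_rank_attained[of "\<lambda>y u. ?t u y", OF this] obtain q2 y \<alpha>2 \<gamma>2 where
    2: "dual_family (\<lambda>u. ?t u y) q2 \<alpha>2 \<gamma>2" "\<And>y. form_rank_le (\<lambda>u. ?t u y) q2" by blast
  have "form_rank_le (\<lambda>u v. ?t u v z) n2" for z
  proof -
    have "(\<lambda>u v. ?t u v z) = contract n3 n1 n2 (\<lambda>k i j. T i j k) z"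
      unfolding contract_rotate[of n1 n2 n3] by (intro ext contract_rotate)
    then show ?thesis by (simp only: form_rank_le_contract)
  qed
  from max_rank_attained[of "\<lambda>z u v. ?t u v z", OF this] obtain q3 z \<alpha>3 \<beta>3 where
    3: "dual_family (\<lambda>u v. ?t u v z) q3 \<alpha>3 \<beta>3" "\<And>z. form_rank_le (\<lambda>u v. ?t u v z) q3" by blast
  note lin = linear_form_contract1 linear_form_contract2 linear_form_contract3
  \<comment> \<open>The leg in the first slot has its slices compressed; the leg in the last slot
    has its dimension bounded.\<close>
  have "n3 \<le> 2 * q2 * (1 + q1)"
    by (rule dim_le_slice_ranks[of "\<lambda>v u w. ?t u v w"])
       (use contract_nondegenerate[OF T3] in \<open>auto intro: lin 1 2\<close>)
  moreover have "n2 \<le> 2 * q1 * (1 + q3)"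
  proof (rule dim_le_slice_ranks[of "\<lambda>u w v. ?t u v w"])
    show "form_rank_le (\<lambda>w v. ?t u v w) q1" for u
      using 1(2)[of u] form_rank_le_swap[of "?t u"] by simp
    show "\<forall>j<n2. v j = 0" if "\<And>u w. ?t u v w = 0" for v
      by (rule contract_nondegenerate[OF T2]) (use that in \<open>simp add: contract_swap[of n1 n2]\<close>)
  qed (auto intro: lin 3)
  moreover have "n1 \<le> 2 * q3 * (1 + q2)"
  proof (rule dim_le_slice_ranks[of "\<lambda>w v u. ?t u v w"])
    show "form_rank_le (\<lambda>v u. ?t u v w) q3" for w
      using 3(2)[of w] form_rank_le_swap[of "\<lambda>u v. ?t u v w"] by simp
    show "form_rank_le (\<lambda>w u. ?t u v w) q2" for v
      using 2(2)[of v] form_rank_le_swap[of "\<lambda>u. ?t u v"] by simp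
    show "\<forall>j<n1. u j = 0" if "\<And>w v. ?t u v w = 0" for u
      by (rule contract_nondegenerate[OF T1]) (use that in \<open>simp add: contract_rotate[of n1 n2]\<close>)
  qed (auto intro: lin)
  ultimately show ?thesis using that 1(1) 2(1) 3(1) by blast
qed

section \<open>Strassen's diagonalization of matrix multiplication\<close>

lemma kronecker_power_mult:
  "kronecker_power n1 n2 n3 T (l * m) =
     kronecker_power (n1 ^ l) (n2 ^ l) (n3 ^ l) (kronecker_power n1 n2 n3 T l) m"
proof (induction m)
  case (Suc m)
  then show ?case using kronecker_power_add[of n1 n2 n3 T "l * m" l] by (simp add: add.commute)
qed simp

text \<open>Kronecker product of \<open>u 0\<close>, ..., \<open>u (m - 1)\<close>, which may differ
  from factor to factor; this is how words are turned into vectors.\<close>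

primrec vec_power :: "nat \<Rightarrow> (nat \<Rightarrow> nat \<Rightarrow> 'a::field) \<Rightarrow> nat \<Rightarrow> nat \<Rightarrow> 'a" where
  "vec_power n u 0 = (\<lambda>_. 1)"
| "vec_power n u (Suc m) = kron_vec n (vec_power n u m) (u m)"

lemma contract_vec_power:
  "contract (n1 ^ m) (n2 ^ m) (n3 ^ m) (kronecker_power n1 n2 n3 T m)
     (vec_power n1 u m) (vec_power n2 v m) (vec_power n3 w m) =
   (\<Prod>t<m. contract n1 n2 n3 T (u t) (v t) (w t))"
proof (induction m)
  case 0
  show ?case by (simp add: contract_def)
next
  case (Suc m)
  show ?case
    using contract_kronecker[of "n1 ^ m" n1 "n2 ^ m" n2 "n3 ^ m" n3 "kronecker_power n1 n2 n3 T m" T]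
    by (simp add: Suc.IH mult.commute)
qed

lemma prod_if_one_zero:
  fixes m :: nat
  shows
  "(\<Prod>t<m. if P t then 1 else 0 :: 'a::comm_semiring_1) = (if \<forall>t<m. P t then 1 else 0)"
  by (induction m) (auto simp: less_Suc_eq)

text \<open>Strassen's weights: \<open>(i + j + k - s)\<^sup>2\<close> splits into terms that depend on two of the indices
  only. Families on which two of the sums of weights are constant therefore span a subtensor in
  which every surviving triple satisfies \<open>i + j + k = s\<close> in each coordinate, hence is diagonal.\<close>

lemma matrix_multiplication_subrank:
  fixes U V W :: "nat \<Rightarrow> nat \<Rightarrow> nat \<Rightarrow> 'a::field"
  assumes "finite D"
    and D: "\<And>i j k. (i, j, k) \<in> D \<Longrightarrow> i + j + k = s"
    and UVW: "\<And>i j k i' j' k' i'' j'' k''. (i, j, k) \<in> D \<Longrightarrow> (i', j', k') \<in> D \<Longrightarrow>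
      (i'', j'', k'') \<in> D \<Longrightarrow> contract n1 n2 n3 T (U j k) (V i' k') (W i'' j'') =
        (if i' = i'' \<and> j = j'' \<and> k = k' then 1 else 0)"
  shows "\<exists>B. \<forall>m. card D ^ m \<le>
    (2 * (B * m) + 1)\<^sup>2 * subrank (n1 ^ m) (n2 ^ m) (n3 ^ m) (kronecker_power n1 n2 n3 T m)"
proof -
  define i j k :: "nat \<times> nat \<times> nat \<Rightarrow> nat"
    where "i = fst" and "j = (\<lambda>d. fst (snd d))" and "k = (\<lambda>d. snd (snd d))"
  \<comment> \<open>Each weight depends on the two indices seen by one family:
    \<open>\<omega>1\<close> on those of \<open>U\<close>, \<open>\<omega>2\<close> on those of
    \<open>V\<close>, \<open>\<omega>3\<close> on those of \<open>W\<close>. Attaching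
    \<open>s\<close> to \<open>i\<close> makes the total a perfect square. All weights are integers,
    whatever the field.\<close>
  define \<omega>1 \<omega>2 where "\<omega>1 = (\<lambda>d. int (j d) ^ 2 + 2 * int (j d) * int (k d))"
    and "\<omega>2 = (\<lambda>d. int (k d) ^ 2 + 2 * int (k d) * (int (i d) - int s))"
  define \<omega>3 where "\<omega>3 = (\<lambda>d. (int (i d) - int s) ^ 2 + 2 * (int (i d) - int s) * int (j d))"
  have sumD: "i d + j d + k d = s" if "d \<in> D" for d
    using that D[of "i d" "j d" "k d"] by (simp add: i_def j_def k_def)
  have \<omega>D: "\<omega>1 d + \<omega>2 d + \<omega>3 d = 0" if "d \<in> D" for d
  proof -
    have "\<omega>1 d + \<omega>2 d + \<omega>3 d = (int (i d) + int (j d) + int (k d) - int s) ^ 2"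
      by (simp add: \<omega>1_def \<omega>2_def \<omega>3_def power2_eq_square algebra_simps)
    also have "int (i d) + int (j d) + int (k d) - int s = 0" using sumD[OF that] by linarith
    finally show ?thesis by simp
  qed
  have contract_D: "contract n1 n2 n3 T (U (j d) (k d)) (V (i d') (k d')) (W (i d'') (j d'')) =
      (if i d' = i d'' \<and> j d = j d'' \<and> k d = k d' then 1 else 0)"
    if "d \<in> D" "d' \<in> D" "d'' \<in> D" for d d' d''
    using that UVW[of "i d" "j d" "k d" "i d'" "j d'" "k d'" "i d''" "j d''" "k d''"]
    by (simp add: i_def j_def k_def)
  \<comment> \<open>A bound on single weights; inserting 0 covers an empty \<open>D\<close>.\<close>
  define B where "B = nat (Max (insert 0 ((\<lambda>d. max \<bar>\<omega>1 d\<bar> \<bar>\<omega>2 d\<bar>) ` D)))"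
  have B: "\<bar>\<omega>1 d\<bar> \<le> int B" "\<bar>\<omega>2 d\<bar> \<le> int B" if "d \<in> D" for d
  proof -
    have "max \<bar>\<omega>1 d\<bar> \<bar>\<omega>2 d\<bar> \<le> Max (insert 0 ((\<lambda>d. max \<bar>\<omega>1 d\<bar> \<bar>\<omega>2 d\<bar>) ` D))"
      using assms(1) that by (intro Max_ge) auto
    then show "\<bar>\<omega>1 d\<bar> \<le> int B" "\<bar>\<omega>2 d\<bar> \<le> int B" by (auto simp: B_def)
  qed
  have "card D ^ m \<le>
    (2 * (B * m) + 1)\<^sup>2 * subrank (n1 ^ m) (n2 ^ m) (n3 ^ m) (kronecker_power n1 n2 n3 T m)" for m
  proof -
    let ?Q = "subrank (n1 ^ m) (n2 ^ m) (n3 ^ m) (kronecker_power n1 n2 n3 T m)"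
    define F where "F = (\<Pi>\<^sub>E t\<in>{..<m}. D)"
    define \<Omega> :: "(nat \<times> nat \<times> nat \<Rightarrow> int) \<Rightarrow> (nat \<Rightarrow> nat \<times> nat \<times> nat) \<Rightarrow> int"
      where "\<Omega> = (\<lambda>\<omega> f. \<Sum>t<m. \<omega> (f t))"
    define box where "box = {- int (B * m)..int (B * m)}"
    \<comment> \<open>Words with prescribed totals for \<open>\<omega>1\<close> and
      \<open>\<omega>2\<close>; the total for \<open>\<omega>3\<close> is then fixed by
      \<open>\<omega>D\<close>.\<close>
    define fibre where "fibre = (\<lambda>(a, b). {f \<in> F. \<Omega> \<omega>1 f = a \<and> \<Omega> \<omega>2 f = b})"
    have finF: "finite F" using assms(1) by (simp add: F_def finite_PiE)
    have FD: "f t \<in> D" if "f \<in> F" "t < m" for f t using that by (auto simp: F_def)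
    have in_box: "\<Omega> \<omega> f \<in> box" if "f \<in> F" "\<And>d. d \<in> D \<Longrightarrow> \<bar>\<omega> d\<bar> \<le> int B" for f \<omega>
    proof -
      have "\<bar>\<Omega> \<omega> f\<bar> \<le> (\<Sum>t<m. \<bar>\<omega> (f t)\<bar>)" unfolding \<Omega>_def by (rule sum_abs)
      also have "\<dots> \<le> (\<Sum>t<m. int B)" using that FD by (intro sum_mono) auto
      finally show ?thesis by (auto simp: box_def mult.commute)
    qed
    have card_fibre: "card (fibre p) \<le> ?Q" for p
    proof (rule card_le_subrank[where
          u = "\<lambda>f. vec_power n1 (\<lambda>t. U (j (f t)) (k (f t))) m" and
          v = "\<lambda>f. vec_power n2 (\<lambda>t. V (i (f t)) (k (f t))) m" and
          w = "\<lambda>f. vec_power n3 (\<lambda>t. W (i (f t)) (j (f t))) m"])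
      show "finite (fibre p)" using finF by (cases p) (simp add: fibre_def)
      fix f g h assume fgh: "f \<in> fibre p" "g \<in> fibre p" "h \<in> fibre p"
      then have F: "f \<in> F" "g \<in> F" "h \<in> F"
        and \<Omega>: "\<Omega> \<omega>1 f = \<Omega> \<omega>1 h" "\<Omega> \<omega>2 g = \<Omega> \<omega>2 h"
        by (auto simp: fibre_def split: prod.splits)
      let ?agree = "\<lambda>t. i (g t) = i (h t) \<and> j (f t) = j (h t) \<and> k (f t) = k (g t)"
      have "f = g \<and> g = h" if agree: "\<And>t. t < m \<Longrightarrow> ?agree t"
      proof -
        define \<sigma> where "\<sigma> = (\<lambda>t. int (i (g t)) + int (j (h t)) + int (k (f t)) - int s)"
        have "(\<sigma> t) ^ 2 = \<omega>1 (f t) + \<omega>2 (g t) + \<omega>3 (h t)" if "t < m" for t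
          using agree[OF that]
          by (simp add: \<sigma>_def \<omega>1_def \<omega>2_def \<omega>3_def power2_eq_square algebra_simps)
        then have "(\<Sum>t<m. (\<sigma> t) ^ 2) = \<Omega> \<omega>1 f + \<Omega> \<omega>2 g + \<Omega> \<omega>3 h"
          by (simp add: \<Omega>_def sum.distrib)
        \<comment> \<open>In a common fibre, \<open>f\<close> and \<open>g\<close> may be replaced
          by \<open>h\<close>, whose weights add up to zero; so all the squares vanish.\<close>
        also have "\<dots> = (\<Sum>t<m. \<omega>1 (h t) + \<omega>2 (h t) + \<omega>3 (h t))"
          unfolding \<Omega> by (simp add: \<Omega>_def sum.distrib)
        also have "\<dots> = 0" using \<omega>D FD[OF F(3)] by simp
        finally have sq: "\<forall>t\<in>{..<m}. (\<sigma> t) ^ 2 = 0"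
          by (subst (asm) sum_nonneg_eq_0_iff) auto
        have \<sigma>: "i (g t) + j (h t) + k (f t) = s" if "t < m" for t
        proof -
          have "\<sigma> t = 0" using sq that by simp
          then show ?thesis unfolding \<sigma>_def by linarith
        qed
        \<comment> \<open>The triple \<open>(i (g t), j (h t), k (f t))\<close> has sum
          \<open>s\<close> and shares two coordinates with each of the three letters, whose sums are
          also \<open>s\<close>; so all four coincide.\<close>
        have eq: "f t = g t" "g t = h t" if "t < m" for t
          using \<sigma>[OF that] agree[OF that] sumD[OF FD[OF F(1) that]] sumD[OF FD[OF F(2) that]]
            sumD[OF FD[OF F(3) that]]
          by (auto simp: i_def j_def k_def prod_eq_iff)
        have "f = g"
          by (rule PiE_ext[OF F(1,2)[unfolded F_def]]) (use eq(1) in simp)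
        moreover have "g = h"
          by (rule PiE_ext[OF F(2,3)[unfolded F_def]]) (use eq(2) in simp)
        ultimately show ?thesis by blast
      qed
      moreover have "?agree t" if "f = g \<and> g = h" for t using that by simp
      moreover have "(\<Prod>t<m. if ?agree t then 1 else 0 :: 'a) = (if \<forall>t<m. ?agree t then 1 else 0)"
        by (rule prod_if_one_zero)
      ultimately have "(\<Prod>t<m. if ?agree t then 1 else 0 :: 'a) = (if f = g \<and> g = h then 1 else 0)"
        by meson
      moreover have "contract (n1 ^ m) (n2 ^ m) (n3 ^ m) (kronecker_power n1 n2 n3 T m)
          (vec_power n1 (\<lambda>t. U (j (f t)) (k (f t))) m) (vec_power n2 (\<lambda>t. V (i (g t)) (k (g t))) m)
          (vec_power n3 (\<lambda>t. W (i (h t)) (j (h t))) m) = (\<Prod>t<m. if ?agree t then 1 else 0)"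
        unfolding contract_vec_power using contract_D FD F by (intro prod.cong refl) auto
      ultimately show "contract (n1 ^ m) (n2 ^ m) (n3 ^ m) (kronecker_power n1 n2 n3 T m)
          (vec_power n1 (\<lambda>t. U (j (f t)) (k (f t))) m) (vec_power n2 (\<lambda>t. V (i (g t)) (k (g t))) m)
          (vec_power n3 (\<lambda>t. W (i (h t)) (j (h t))) m) = (if f = g \<and> g = h then 1 else 0)"
        by (rule trans[rotated])
    qed
    have "card D ^ m = card F" by (simp add: F_def card_PiE)
    \<comment> \<open>Pigeonhole: the words fall into a number of fibres quadratic in
      \<open>m\<close>, and each fibre gives a diagonal restriction.\<close>
    also have "F = (\<Union>p\<in>box \<times> box. fibre p)"
      using in_box B by (auto simp: fibre_def)
    also have "card \<dots> \<le> (\<Sum>p\<in>box \<times> box. card (fibre p))"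
      by (rule card_UN_le) (simp add: box_def)
    also have "\<dots> \<le> (\<Sum>p\<in>box \<times> box. ?Q)" by (intro sum_mono card_fibre)
    also have "\<dots> = (2 * (B * m) + 1)\<^sup>2 * ?Q"
    proof -
      have "card {- int N..int N} = 2 * N + 1" for N by auto
      then have "card box = 2 * (B * m) + 1" unfolding box_def .
      then show ?thesis by (simp add: card_cartesian_product power2_eq_square)
    qed
    finally show ?thesis .
  qed
  then show ?thesis by blast
qed

text \<open>Let the two indices with the smaller ranges run through the lower halves, and let
  \<open>s\<close> be the greatest value of the third; the third index is then determined and stays
  in range. Each half, rounded up, costs a factor of at most 2.\<close>

lemma many_triples_with_sum:
  fixes a b c :: nat
  defines "D \<equiv> \<lambda>s. {(i, j, k). i < a \<and> j < b \<and> k < c \<and> i + j + k = s}"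
  shows "\<exists>s. min (a * b) (min (a * c) (b * c)) \<le> 4 * card (D s)"
proof -
  have finD: "finite (D s)" for s
    by (rule finite_subset[of _ "{..<a} \<times> {..<b} \<times> {..<c}"]) (auto simp: D_def)
  let ?H = "\<lambda>x y. {..<(x + 1) div 2} \<times> {..<(y + 1) div 2} :: (nat \<times> nat) set"
  have H: "x * y \<le> 4 * card (?H x y)" for x y :: nat
  proof -
    have "x * y \<le> (2 * ((x + 1) div 2)) * (2 * ((y + 1) div 2))" by (intro mult_mono) auto
    then show ?thesis by (simp add: card_cartesian_product)
  qed
  consider "a \<le> c" "b \<le> c" | "a \<le> b" "c \<le> b" | "b \<le> a" "c \<le> a" by linarith
  then show ?thesis
  proof cases
    case 1
    have "card (?H a b) \<le> card (D (c - 1))"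
      by (rule card_inj_on_le[of "\<lambda>(i, j). (i, j, c - 1 - i - j)"])
         (use 1 finD in \<open>auto simp: D_def inj_on_def\<close>)
    then show ?thesis using H[of a b] by (intro exI[of _ "c - 1"]) simp
  next
    case 2
    have "card (?H a c) \<le> card (D (b - 1))"
      by (rule card_inj_on_le[of "\<lambda>(i, k). (i, b - 1 - i - k, k)"])
         (use 2 finD in \<open>auto simp: D_def inj_on_def\<close>)
    then show ?thesis using H[of a c] by (intro exI[of _ "b - 1"]) simp
  next
    case 3
    have "card (?H b c) \<le> card (D (a - 1))"
      by (rule card_inj_on_le[of "\<lambda>(j, k). (a - 1 - j - k, j, k)"])
         (use 3 finD in \<open>auto simp: D_def inj_on_def\<close>)
    then show ?thesis using H[of b c] by (intro exI[of _ "a - 1"]) simp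
  qed
qed

text \<open>\<open>d\<close> counts triples with constant sum. The 16 combines a 4 from
  \<open>2 * a * (1 + b) \<le> 4 * (a * b)\<close> with a 4 from
  \<open>many_triples_with_sum\<close>; being independent of \<open>l\<close>, it can be removed
  later.\<close>

lemma concise_power_subrank:
  fixes T :: "'a::field tensor"
  assumes T: "concise n1 n2 n3 T" and n: "0 < n1" "0 < n2" "0 < n3"
  shows "\<exists>d B. Min {n1, n2, n3} ^ l \<le> 16 * d \<and> (\<forall>m. d ^ m \<le> (2 * (B * m) + 1)\<^sup>2 *
    subrank (n1 ^ (3 * l * m)) (n2 ^ (3 * l * m)) (n3 ^ (3 * l * m))
      (kronecker_power n1 n2 n3 T (3 * l * m)))"
proof -
  let ?P = "kronecker_power n1 n2 n3 T"
  let ?t = "contract (n1 ^ l) (n2 ^ l) (n3 ^ l) (?P l)"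
  have nondeg: "leg3_nondegenerate (n1 ^ l) (n2 ^ l) (n3 ^ l) (?P l)"
    "leg3_nondegenerate (n1 ^ l) (n3 ^ l) (n2 ^ l) (\<lambda>i k j. ?P l i j k)"
    "leg3_nondegenerate (n2 ^ l) (n3 ^ l) (n1 ^ l) (\<lambda>j k i. ?P l i j k)"
    using concise_nondegenerate[OF T, THEN leg3_nondegenerate_power]
    by (simp_all only: kronecker_power_permute)
  obtain q1 q2 q3 x \<beta>1 \<gamma>1 y \<alpha>2 \<gamma>2 z \<alpha>3 \<beta>3 where
    dual: "dual_family (?t x) q1 \<beta>1 \<gamma>1" "dual_family (\<lambda>u. ?t u y) q2 \<alpha>2 \<gamma>2"
      "dual_family (\<lambda>u v. ?t u v z) q3 \<alpha>3 \<beta>3" and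
    le: "n1 ^ l \<le> 2 * q3 * (1 + q2)" "n2 ^ l \<le> 2 * q1 * (1 + q3)" "n3 ^ l \<le> 2 * q2 * (1 + q1)"
    by (rule slice_families[OF nondeg])
  have pos: "q1 > 0" "q2 > 0" "q3 > 0" using le n by (auto intro!: gr0I)
  let ?\<nu> = "Min {n1, n2, n3}"
  have le4: "2 * a * (1 + b) \<le> 4 * (a * b)" if "b > 0" for a b :: nat
  proof -
    have "a * (1 + b) \<le> a * (2 * b)" using that by (intro mult_left_mono) auto
    then show ?thesis by simp
  qed
  have "n1 ^ l \<le> 4 * (q2 * q3)" "n2 ^ l \<le> 4 * (q1 * q3)" "n3 ^ l \<le> 4 * (q1 * q2)"
    using order_trans[OF le(1) le4] order_trans[OF le(2) le4] order_trans[OF le(3) le4] pos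
    by (simp_all add: mult.commute)
  moreover have "?\<nu> ^ l \<le> n1 ^ l" "?\<nu> ^ l \<le> n2 ^ l" "?\<nu> ^ l \<le> n3 ^ l"
    by (auto intro!: power_mono)
  ultimately have \<nu>: "?\<nu> ^ l \<le> 4 * min (q1 * q2) (min (q1 * q3) (q2 * q3))"
    by linarith
  obtain s where s: "min (q1 * q2) (min (q1 * q3) (q2 * q3)) \<le>
      4 * card {(i, j, k). i < q1 \<and> j < q2 \<and> k < q3 \<and> i + j + k = s}"
    using many_triples_with_sum[of q1 q2 q3] by blast
  define D where "D = {(i, j, k). i < q1 \<and> j < q2 \<and> k < q3 \<and> i + j + k = s}"
  \<comment> \<open>In each of the three factors one leg receives a fixed vector: \<open>x\<close>
    in leg 1 of the first, \<open>y\<close> in leg 2 of the second, \<open>z\<close> in leg 3 of the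
    third. The contraction is then a product of three Kronecker deltas, the matrix multiplication
    tensor.\<close>
  define U where "U = (\<lambda>j k. kron_vec (n1 ^ l) (kron_vec (n1 ^ l) x (\<alpha>2 j)) (\<alpha>3 k))"
  define V where "V = (\<lambda>i k. kron_vec (n2 ^ l) (kron_vec (n2 ^ l) (\<beta>1 i) y) (\<beta>3 k))"
  define W where "W = (\<lambda>i j. kron_vec (n3 ^ l) (kron_vec (n3 ^ l) (\<gamma>1 i) (\<gamma>2 j)) z)"
  have three: "3 * l = l + l + l" by simp
  have pow: "n ^ (3 * l) = n ^ l * n ^ l * n ^ l" for n :: nat
    by (simp only: three power_add)
  have P3: "?P (3 * l) = kronecker (n1 ^ l) (n2 ^ l) (n3 ^ l)
      (kronecker (n1 ^ l) (n2 ^ l) (n3 ^ l) (?P l) (?P l)) (?P l)"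
    by (simp only: three kronecker_power_add)
  have "\<exists>B. \<forall>m. card D ^ m \<le> (2 * (B * m) + 1)\<^sup>2 *
      subrank ((n1 ^ (3 * l)) ^ m) ((n2 ^ (3 * l)) ^ m) ((n3 ^ (3 * l)) ^ m)
        (kronecker_power (n1 ^ (3 * l)) (n2 ^ (3 * l)) (n3 ^ (3 * l)) (?P (3 * l)) m)"
  proof (rule matrix_multiplication_subrank)
    show "finite D"
      by (rule finite_subset[of _ "{..<q1} \<times> {..<q2} \<times> {..<q3}"]) (auto simp: D_def)
    show "contract (n1 ^ (3 * l)) (n2 ^ (3 * l)) (n3 ^ (3 * l)) (?P (3 * l)) (U j k) (V i' k') (W i'' j'')
        = (if i' = i'' \<and> j = j'' \<and> k = k' then 1 else 0)"
      if "(i, j, k) \<in> D" "(i', j', k') \<in> D" "(i'', j'', k'') \<in> D"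
      for i j k i' j' k' i'' j'' k''
      using that dual
      by (simp add: pow P3 U_def V_def W_def contract_kronecker D_def dual_family_def)
  qed (simp add: D_def)
  then obtain B where B: "card D ^ m \<le> (2 * (B * m) + 1)\<^sup>2 *
      subrank (n1 ^ (3 * l * m)) (n2 ^ (3 * l * m)) (n3 ^ (3 * l * m)) (?P (3 * l * m))" for m
    unfolding kronecker_power_mult[symmetric] power_mult[symmetric] by blast
  have "?\<nu> ^ l \<le> 16 * card D" using \<nu> s by (simp add: D_def)
  then show ?thesis using B by blast
qed

section \<open>The asymptotic bound\<close>

lemma superadditive_mult:
  fixes x :: "nat \<Rightarrow> real"
  assumes "\<And>m n. x m + x n \<le> x (m + n)" "\<And>n. 0 \<le> x n"
  shows "real d * x k \<le> x (k * d)"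
proof (induction d)
  case (Suc d)
  have "real (Suc d) * x k \<le> x (k * d) + x k" using Suc by (simp add: algebra_simps)
  also have "\<dots> \<le> x (k * Suc d)" using assms(1)[of "k * d" k] by (simp add: add.commute)
  finally show ?case .
qed (use assms in simp)

text \<open>Division with remainder by a fixed \<open>k\<close> bounds \<open>x n / real n\<close>
  below by \<open>(1 - real k / real n) * (x k / real k)\<close>, so the quotients tend to their
  supremum.\<close>

lemma fekete_superadditive:
  fixes x :: "nat \<Rightarrow> real"
  assumes add: "\<And>m n. x m + x n \<le> x (m + n)" and nonneg: "\<And>n. 0 \<le> x n"
    and bound: "\<And>n. x n \<le> K * real n"
  shows "convergent (\<lambda>n. x n / real n)"
proof -
  define L where "L = (SUP n\<in>{1..}. x n / real n)"
  have bdd: "bdd_above ((\<lambda>n. x n / real n) ` {1..})"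
    using bound by (intro bdd_aboveI2[of _ _ K]) (simp add: divide_le_eq)
  have "(\<lambda>n. x n / real n) \<longlonglongrightarrow> L"
  proof (rule order_tendstoI)
    fix a assume "a < L"
    then obtain k where k: "k \<ge> 1" "a < x k / real k"
      unfolding L_def using less_cSUP_iff[OF _ bdd] by auto
    have "((\<lambda>n. (1 - real k / real n) * (x k / real k)) \<longlongrightarrow> (1 - 0) * (x k / real k)) sequentially"
      by (intro tendsto_intros lim_const_over_n)
    then have "eventually (\<lambda>n. a < (1 - real k / real n) * (x k / real k)) sequentially"
      using k by (intro order_tendstoD(1)[of _ "x k / real k"]) simp_all
    then show "eventually (\<lambda>n. a < x n / real n) sequentially"
      using eventually_gt_at_top[of 0]
    proof eventually_elim
      case (elim n)
      have "x (k * (n div k)) + x (n mod k) \<le> x n"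
        using add[of "k * (n div k)" "n mod k"] by simp
      then have "real (n div k) * x k \<le> x n"
        using superadditive_mult[of x "n div k" k, OF add nonneg] nonneg[of "n mod k"] by linarith
      moreover have "real n - real k \<le> real (n div k) * real k"
      proof -
        have "n mod k \<le> k" using k(1) by (simp add: less_imp_le)
        moreover have "real n = real (n div k) * real k + real (n mod k)"
          by (simp flip: of_nat_mult of_nat_add)
        ultimately show ?thesis by linarith
      qed
      then have "(real n - real k) * (x k / real k) \<le> real (n div k) * real k * (x k / real k)"
        using nonneg k by (intro mult_right_mono) auto
      ultimately have "(real n - real k) * (x k / real k) \<le> x n" using k by simp
      then have "(real n - real k) * (x k / real k) / real n \<le> x n / real n"
        by (intro divide_right_mono) auto
      moreover have "(real n - real k) * (x k / real k) / real n = (1 - real k / real n) * (x k / real k)"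
        using elim by (simp add: field_simps)
      ultimately show ?case using elim by simp
    qed
  next
    fix a assume a: "L < a"
    show "eventually (\<lambda>n. x n / real n < a) sequentially"
      using eventually_ge_at_top[of 1]
    proof eventually_elim
      case (elim n)
      have "x n / real n \<le> L" unfolding L_def using elim by (intro cSUP_upper[OF _ bdd]) auto
      then show ?case using a by simp
    qed
  qed
  then show ?thesis by (rule convergentI)
qed

lemma convergent_root_supermultiplicative:
  fixes a :: "nat \<Rightarrow> nat"
  assumes pos: "\<And>m. 1 \<le> a m" and mult: "\<And>m n. a m * a n \<le> a (m + n)"
    and bound: "\<And>m. a m \<le> C ^ m"
  shows "convergent (\<lambda>m. root m (real (a m)))"
proof -
  define x where "x = (\<lambda>m. ln (real (a m)))"
  have pos': "0 < real (a m)" for m using pos[of m] by simp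
  have C: "0 < real C" using pos[of 1] bound[of 1] by simp
  have "convergent (\<lambda>m. x m / real m)"
  proof (rule fekete_superadditive)
    show "x m + x n \<le> x (m + n)" for m n
    proof -
      have "x m + x n = ln (real (a m * a n))" using pos' by (simp add: x_def ln_mult)
      also have "\<dots> \<le> x (m + n)" unfolding x_def
        using pos'[of m] pos'[of n] pos'[of "m + n"] mult[of m n]
        by (subst ln_le_cancel_iff) (simp_all del: of_nat_mult)
      finally show ?thesis .
    qed
    show "0 \<le> x n" for n using pos[of n] by (simp add: x_def)
    show "x n \<le> ln (real C) * real n" for n
    proof -
      have "real (a n) \<le> real C ^ n" using bound[of n] by (metis of_nat_le_iff of_nat_power)
      then have "x n \<le> ln (real C ^ n)" unfolding x_def using pos' C by (subst ln_le_cancel_iff) auto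
      then show ?thesis using C by (simp add: ln_realpow mult.commute)
    qed
  qed
  then obtain l where "(\<lambda>m. x m / real m) \<longlonglongrightarrow> l" by (auto simp: convergent_def)
  then have "(\<lambda>m. exp (x m / real m)) \<longlonglongrightarrow> exp l" by (rule tendsto_exp)
  \<comment> \<open>At index 0 the two sides are 1 and 0, so they agree only from 1 on.\<close>
  moreover have "eventually (\<lambda>m. exp (x m / real m) = root m (real (a m))) sequentially"
    using eventually_gt_at_top[of 0]
  proof eventually_elim
    case (elim m)
    have "exp (x m / real m) ^ m = real (a m)"
      using elim pos' by (simp add: x_def exp_of_nat_mult[symmetric])
    then show ?case using elim by (metis exp_ge_zero real_root_power_cancel)
  qed
  ultimately have "(\<lambda>m. root m (real (a m))) \<longlonglongrightarrow> exp l" by (rule Lim_transform_eventually)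
  then show ?thesis by (rule convergentI)
qed

section \<open>Removal of polynomial and constant factors\<close>

text \<open>The number of fibres is polynomial in \<open>m\<close> and disappears under the
  \<open>m\<close>-th root.\<close>

lemma root_quadratic_tendsto_1: "(\<lambda>m. root m ((2 * (real B * real m) + 1)\<^sup>2)) \<longlonglongrightarrow> 1"
proof (rule tendsto_sandwich)
  show "(\<lambda>m. 1) \<longlonglongrightarrow> (1::real)" by simp
  have "(\<lambda>m. (root m (2 * real B + 1) * root m (real m))\<^sup>2) \<longlonglongrightarrow> (1 * 1)\<^sup>2"
    by (intro tendsto_intros LIMSEQ_root LIMSEQ_root_const) (simp add: add_nonneg_pos)
  then show "(\<lambda>m. (root m (2 * real B + 1) * root m (real m))\<^sup>2) \<longlonglongrightarrow> 1" by simp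
  show "eventually (\<lambda>m. 1 \<le> root m ((2 * (real B * real m) + 1)\<^sup>2)) sequentially"
    using eventually_gt_at_top[of 0]
    by eventually_elim simp
  show "eventually (\<lambda>m. root m ((2 * (real B * real m) + 1)\<^sup>2) \<le>
      (root m (2 * real B + 1) * root m (real m))\<^sup>2) sequentially"
    using eventually_gt_at_top[of 0]
  proof eventually_elim
    case (elim m)
    have "2 * (real B * real m) + 1 \<le> (2 * real B + 1) * real m"
      using elim by (simp add: algebra_simps)
    then have "root m ((2 * (real B * real m) + 1)\<^sup>2) \<le> root m (((2 * real B + 1) * real m)\<^sup>2)"
      using elim by (intro real_root_le_mono power_mono) auto
    then show ?case using elim by (simp add: real_root_power real_root_mult)
  qed
qed

text \<open>For \<open>b < a\<close> the quantity \<open>C * (b / a) ^ l\<close> would tend to 0 and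
  drop below 1.\<close>

lemma le_of_power_le_mult_power:
  fixes a b C :: real
  assumes "0 \<le> a" "0 \<le> b" and le: "\<And>l. l > 0 \<Longrightarrow> a ^ l \<le> C * b ^ l"
  shows "a \<le> b"
proof (rule ccontr)
  assume "\<not> a \<le> b"
  then have ab: "b < a" "0 < a" using assms by auto
  have "(\<lambda>l. C * (b / a) ^ l) \<longlonglongrightarrow> C * 0"
    using ab assms by (intro tendsto_mult tendsto_const LIMSEQ_power_zero) simp
  then have "eventually (\<lambda>l. C * (b / a) ^ l < 1) sequentially"
    by (intro order_tendstoD(2)[of _ 0]) auto
  then have "eventually (\<lambda>l. C * (b / a) ^ l < 1 \<and> l > 0) sequentially"
    using eventually_gt_at_top by (rule eventually_conj)
  then have "\<exists>l. C * (b / a) ^ l < 1 \<and> l > 0"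
    by (rule eventually_happens'[OF sequentially_bot])
  then obtain l where l: "C * (b / a) ^ l < 1" "l > 0" by blast
  have "C * b ^ l < a ^ l" using l(1) ab by (simp add: power_divide divide_less_eq)
  then show False using le[OF l(2)] by simp
qed

theorem theorem2p12:
  fixes T :: "'a::field tensor" and n1 n2 n3 :: nat
  assumes "concise n1 n2 n3 T"
  shows "convergent (subrank_root n1 n2 n3 T) \<and>
         asymptotic_subrank n1 n2 n3 T \<ge> root 3 (real (Min {n1, n2, n3}))"
proof -
  define P where "P = kronecker_power n1 n2 n3 T"
  define Q where "Q = (\<lambda>m. subrank (n1 ^ m) (n2 ^ m) (n3 ^ m) (P m))"
  have root_def: "subrank_root n1 n2 n3 T = (\<lambda>m. root m (real (Q m)))"
    by (simp add: fun_eq_iff subrank_root_def Q_def P_def)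
  note nondeg = concise_nondegenerate[OF assms]
  show ?thesis
  proof (cases "n1 = 0 \<or> n2 = 0 \<or> n3 = 0")
    \<comment> \<open>If \<open>n2\<close> or \<open>n3\<close> vanishes, the conditions on the
      all-ones vector of leg 1 are empty, so conciseness forces \<open>n1 = 0\<close>. Then every
      root is 0; at \<open>m = 0\<close> this is the convention for \<open>root 0\<close>.\<close>
    case True
    have "n1 = 0"
      using nondeg(3)[unfolded leg3_nondegenerate_def, rule_format, of "\<lambda>_. 1" 0] True by auto
    then have "Q m = 0" if "m > 0" for m
      using subrank_le[of "n1 ^ m" "n2 ^ m" "n3 ^ m" "P m"] that by (simp add: Q_def zero_power)
    then have "subrank_root n1 n2 n3 T = (\<lambda>m. 0)"
      unfolding root_def by (intro ext) (metis gr0I of_nat_0 real_root_zero root_0)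
    moreover have "Min {n1, n2, n3} = 0" using \<open>n1 = 0\<close> by simp
    ultimately show ?thesis
      by (simp add: asymptotic_subrank_def convergent_const)
  next
    case False
    then have n: "0 < n1" "0 < n2" "0 < n3" by auto
    have mult: "Q l * Q m \<le> Q (l + m)" for l m
      unfolding Q_def P_def kronecker_power_add power_add by (rule subrank_kronecker)
    \<comment> \<open>Logarithms need positive subranks. As \<open>n3 > 0\<close>, the form of
      \<open>T\<close> takes a nonzero value; its \<open>m\<close>-th power, scaled to 1, realizes a
      unit tensor of size 1.\<close>
    obtain u v where uv: "contract n1 n2 n3 T u v (\<lambda>_. 1) \<noteq> 0"
      using contract_nondegenerate[OF nondeg(1), of "\<lambda>_. 1"] n by auto
    have Q_pos: "1 \<le> Q m" for m
    proof -
      let ?w = "vec_power n3 (\<lambda>_ _. 1) m"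
      let ?c = "contract (n1 ^ m) (n2 ^ m) (n3 ^ m) (P m) (vec_power n1 (\<lambda>_. u) m) (vec_power n2 (\<lambda>_. v) m) ?w"
      have c: "?c \<noteq> 0" using uv by (simp add: P_def contract_vec_power)
      have "card {()} \<le> Q m"
        unfolding Q_def
      proof (rule card_le_subrank)
        show "contract (n1 ^ m) (n2 ^ m) (n3 ^ m) (P m) (vec_power n1 (\<lambda>_. u) m) (vec_power n2 (\<lambda>_. v) m)
            (\<lambda>i. inverse ?c * ?w i) = (if a = b \<and> b = c then 1 else 0)" for a b c :: unit
          using c by (simp add: linear_form_scale[OF linear_form_contract3])
      qed simp
      then show ?thesis by simp
    qed
    have "convergent (subrank_root n1 n2 n3 T)"
      unfolding root_def
      by (rule convergent_root_supermultiplicative[of _ n1])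
         (use Q_pos mult subrank_le in \<open>auto simp: Q_def\<close>)
    then obtain L where L: "subrank_root n1 n2 n3 T \<longlonglongrightarrow> L" by (auto simp: convergent_def)
    have "L \<ge> 0"
      by (rule LIMSEQ_le_const[OF L]) (simp add: root_def real_root_ge_zero)
    let ?\<nu> = "real (Min {n1, n2, n3})"
    have "?\<nu> ^ l \<le> 16 * (L ^ 3) ^ l" if l: "l > 0" for l
    proof -
      obtain d B where d: "Min {n1, n2, n3} ^ l \<le> 16 * d"
        and dB: "\<And>m. d ^ m \<le> (2 * (B * m) + 1)\<^sup>2 * Q (3 * l * m)"
        using concise_power_subrank[OF assms n, of l] unfolding Q_def P_def by blast
      \<comment> \<open>The estimate concerns exponents \<open>3 * l * m\<close>; since the limit
        exists, it can be taken along this subsequence.\<close>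
      have "filterlim (\<lambda>m. 3 * l * m) at_top sequentially"
        using l by (intro filterlim_subseq) (auto simp: strict_mono_def)
      with L have "(\<lambda>m. subrank_root n1 n2 n3 T (3 * l * m)) \<longlonglongrightarrow> L"
        by (rule filterlim_compose)
      then have lim: "(\<lambda>m. root m ((2 * (real B * real m) + 1)\<^sup>2) * subrank_root n1 n2 n3 T (3 * l * m) ^ (3 * l))
          \<longlonglongrightarrow> 1 * L ^ (3 * l)"
        by (intro tendsto_mult root_quadratic_tendsto_1 tendsto_power)
      have "real d \<le> root m ((2 * (real B * real m) + 1)\<^sup>2) * subrank_root n1 n2 n3 T (3 * l * m) ^ (3 * l)"
        if m: "m > 0" for m
      proof -
        have "real (d ^ m) \<le> real ((2 * (B * m) + 1)\<^sup>2 * Q (3 * l * m))"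
          using dB[of m] by (simp only: of_nat_le_iff)
        then have "root m (real d ^ m) \<le> root m ((2 * (real B * real m) + 1)\<^sup>2 * real (Q (3 * l * m)))"
          using m by (intro real_root_le_mono) (simp_all add: algebra_simps)
        also have "root m (real d ^ m) = real d" using m by (simp add: real_root_power_cancel)
        also have "root m ((2 * (real B * real m) + 1)\<^sup>2 * real (Q (3 * l * m))) =
            root m ((2 * (real B * real m) + 1)\<^sup>2) * root m (real (Q (3 * l * m)))"
          by (rule real_root_mult)
        also have "root m (real (Q (3 * l * m))) = subrank_root n1 n2 n3 T (3 * l * m) ^ (3 * l)"
          unfolding root_def real_root_mult_exp[of "3 * l" m] using l m
          by (intro real_root_pow_pos2[symmetric]) (simp_all add: real_root_ge_zero)
        finally show ?thesis .
      qed
      then have "real d \<le> 1 * L ^ (3 * l)"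
        by (intro LIMSEQ_le_const[OF lim]) (auto intro!: exI[of _ 1])
      moreover have "?\<nu> ^ l \<le> 16 * real d"
        using d by (metis of_nat_le_iff of_nat_mult of_nat_numeral of_nat_power)
      ultimately show ?thesis by (simp add: power_mult)
    qed
    \<comment> \<open>The same 16 works for every positive \<open>l\<close>, so comparing growth in
      \<open>l\<close> removes it.\<close>
    then have "?\<nu> \<le> L ^ 3"
      using \<open>L \<ge> 0\<close> by (intro le_of_power_le_mult_power[of ?\<nu> "L ^ 3" 16]) simp_all
    then have "root 3 ?\<nu> \<le> root 3 (L ^ 3)" by (intro real_root_le_mono) simp_all
    also have "\<dots> = L" using \<open>L \<ge> 0\<close> by (simp add: real_root_power_cancel)
    also have "L = asymptotic_subrank n1 n2 n3 T"
      using L by (simp add: asymptotic_subrank_def limI)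
    finally show ?thesis using L by (auto simp: convergent_def)
  qed
qed

end
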